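(* Let $\mu\in\mathcal{P}$, let $(u^{n+1}(\mu),\lambda^{n+1}(\mu))\in V\times M$, $0\le n\le L-1$, be the solution of the detailed problem with initial value $u^0(\mu)\in V$, and let $(u_N^{n+1}(\mu),\lambda_N^{n+1}(\mu))\in V_N\times M_N$, $0\le n\le L-1$, be the solution of the reduced problem (detailed and reduced problem as defined in the context). If $u^0(\mu)\in V_N$ and, for all $0\le n\le L-1$, $u^{n+1}(\mu)\in V_N$ and $\lambda^{n+1}(\mu)\in M_N$, then $$u_N^{n+1}(\mu)=u^{n+1}(\mu),\qquad \lambda_N^{n+1}(\mu)=\lambda^{n+1}(\mu)\qquad\text{for all } n=0,\ldots,L-1 .$$
   Context: **Spaces.** $\Omega\subset\mathbb{R}^d$ ($d=1$ or $2$) is a bounded open domain with Lipschitz boundary (an interval $(x_{\min},x_{\max})$ if $d=1$; a rectangle $(v_{\min},v_{\max})\times(x_{\min},x_{\max})$ with $v_{\min}>0$ if $d=2$). $\partial\Omega_D\subset\partial\Omega$ is the Dirichlet part of the boundary (both end points if $d=1$; the three sides $v=v_{\min}$, $x=x_{\min}$, $x=x_{\max}$ if $d=2$). $V=\{\phi\in H^1(\Omega):\phi=0\text{ on }\partial\Omega_D\}$ is a Hilbert space with inner product $\langle\cdot,\cdot\rangle_V$ and norm $\|\cdot\|_V$, and there is a constant $C_\Omega$ with $\|v\|_{L^2(\Omega)}\le C_\Omega\|v\|_V$ for all $v\in V$. $W:=V'$ is the dual of $V$ (a Hilbert space with the dual norm), and $b:W\times V\to\mathbb{R}$, $b(\eta,v)=\langle\eta,v\rangle_{V',V}$,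 is the duality pairing. $M\subset W$ is a (closed convex) cone, called the dual cone. **Forms.** $\mu\in\mathcal{P}\subset\mathbb{R}^p$ is a parameter. $a(\cdot,\cdot;\mu)$ is one of the following two bilinear forms. - Black-Scholes ($d=1$, $\mu=(\sigma,q,r)$): $a(w,\phi;\mu)=\frac12\sigma^2\langle\partial_xw,\partial_x\phi\rangle_{L^2(\Omega)}-(r-q)\langle\partial_xw,\phi\rangle_{L^2(\Omega)}+r\langle w,\phi\rangle_{L^2(\Omega)}$. - Heston ($d=2$, variables $(v,x)$, $\nabla=(\partial_v,\partial_x)^T$, $\mu=(\xi,\rho,\gamma,\kappa,r)$): $a(w,\phi;\mu)=\langle A\nabla w,\nabla\phi\rangle_{L^2(\Omega)}+\langle \mathbf{b}\cdot\nabla w,\phi\rangle_{L^2(\Omega)}+r\langle w,\phi\rangle_{L^2(\Omega)}$ with $A=\frac12 v\begin{bmatrix}\xi^2&\rho\xi\\ \rho\xi&1\end{bmatrix}$, $\mathbf{b}=\begin{bmatrix}-\kappa(\gamma-v)+\frac12\xi^2\\ -r+\frac12v+\frac12\xi\rho\end{bmatrix}$. It is assumed that, for every $\mu\in\mathcal{P}$, $a(\cdot,\cdot;\mu)$ is coercive and continuous on $V$: $\alpha_a(\mu)=\inf_{0\ne u\in V}\frac{a(u,u;\mu)}{\|u\|_V^2}>0$ and $\gamma_a(\mu)=\sup_{0\neq u\in V}\sup_{0\ne v\in V}\frac{a(u,v;\mu)}{\|u\|_V\|v\|_V}<\infty$, and that $b$ is inf-sup stable: $\beta=\inf_{0\ne\eta\in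 W}\sup_{0\ne v\in V}\frac{b(\eta,v)}{\|\eta\|_W\|v\|_V}>0$. **Time discretization and data.** $T>0$, $L\in\mathbb{N}$, $\Delta t=T/L$, $\theta\in[0,1]$. $w^0(x)=\max(0,K-Ke^x)$ with $K>0$ is the payoff, and $u_g^n\in H^1(\Omega)$, $0\le n\le L$, are given lift functions with $u_g^n=w^0$ on $\partial\Omega_D$. For $0\le n\le L-1$, $\phi\in V$, $\eta\in W$, $$f^n(\phi;\mu)=-\Big\langle\tfrac{u_g^{n+1}-u_g^n}{\Delta t},\phi\Big\rangle_{L^2(\Omega)}-a(\theta u_g^{n+1}+(1-\theta)u_g^n,\phi;\mu),\qquad g^n(\eta;\mu)=b(\eta,w^0-u_g^{n+1}).$$ **Detailed problem.** Given $u^0\in V$, find $(u^{n+1},\lambda^{n+1})\in V\times M$, $0\le n\le L-1$, such that for all $\phi\in V$, $\eta\in M$ $$\Big\langle\tfrac{u^{n+1}-u^n}{\Delta t},\phi\Big\rangle_{L^2(\Omega)}+a(\theta u^{n+1}+(1-\theta)u^n,\phi;\mu)-b(\lambda^{n+1},\phi)=f^n(\phi;\mu),$$ $$b(\eta-\lambda^{n+1},u^{n+1})\ge g^n(\eta-\lambda^{n+1};\mu).$$ **Reduced problem.** $V_N=\mathrm{span}\{\psi_1,\dots,\psi_{N_V}\}\subset V$ and $W_N=\mathrm{span}\{\xi_1,\dots,\xi_{N_W}\}\subset W$ with $\psi_i\in V$ linearly independent and $\xi_j\in M$ linearly independent; $M_N=\{\sum_{j=1}^{N_W}\alpha_j\xi_j:\alpha_j\ge0\}\subseteq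 M$. The spaces are such that $\beta_N=\inf_{0\ne\eta_N\in W_N}\sup_{0\ne v_N\in V_N}\frac{b(\eta_N,v_N)}{\|\eta_N\|_W\|v_N\|_V}\ge\beta>0$. Find $(u_N^{n+1},\lambda_N^{n+1})\in V_N\times M_N$, $0\le n\le L-1$, such that for all $v_N\in V_N$, $\eta_N\in M_N$ $$\Big\langle\tfrac{u_N^{n+1}-u_N^n}{\Delta t},v_N\Big\rangle_{L^2(\Omega)}+a(\theta u_N^{n+1}+(1-\theta)u_N^n,v_N;\mu)-b(\lambda_N^{n+1},v_N)=f^n(v_N;\mu),$$ $$b(\eta_N-\lambda_N^{n+1},u_N^{n+1})\ge g^n(\eta_N-\lambda_N^{n+1};\mu),$$ where $u_N^0\in V_N$ is the $V$-orthogonal projection of $u^0$: $\langle u_N^0-u^0,v_N\rangle_V=0$ for all $v_N\in V_N$. *)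

theory Defs
  imports "HOL-Analysis.Analysis"
begin

section \<open>Functions up to equality almost everywhere\<close>

definition ae_eq :: "('a::euclidean_space \<Rightarrow> real) \<Rightarrow> ('a \<Rightarrow> real) \<Rightarrow> bool" where
  "ae_eq f g \<longleftrightarrow> (AE x in lebesgue. f x = g x)"

lemma ae_eq_equivp: "equivp (ae_eq :: ('a::euclidean_space \<Rightarrow> real) \<Rightarrow> _)"
proof (rule equivpI)
  show "reflp (ae_eq :: ('a \<Rightarrow> real) \<Rightarrow> _)" by (simp add: reflp_def ae_eq_def)
  show "symp (ae_eq :: ('a \<Rightarrow> real) \<Rightarrow> _)"
    unfolding symp_def ae_eq_def by (metis (mono_tags, lifting) eventually_mono)
  show "transp (ae_eq :: ('a \<Rightarrow> real) \<Rightarrow> _)"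
    unfolding transp_def ae_eq_def by (intro allI impI) (elim AE_mp, auto)
qed

text \<open>The elements of the function spaces over \<open>\<Omega>\<close> are classes of functions on the whole
  space that vanish outside \<open>\<Omega>\<close>, so that equality in these spaces is HOL equality.\<close>

quotient_type (overloaded) 'a ae_fun = "'a::euclidean_space \<Rightarrow> real" / ae_eq
  by (rule ae_eq_equivp)

instantiation ae_fun :: (euclidean_space) real_vector
begin

lift_definition zero_ae_fun :: "'a ae_fun" is "\<lambda>x. 0" .

lift_definition plus_ae_fun :: "'a ae_fun \<Rightarrow> 'a ae_fun \<Rightarrow> 'a ae_fun" is "\<lambda>f g x. f x + g x"
  unfolding ae_eq_def by (elim AE_mp) auto

lift_definition minus_ae_fun :: "'a ae_fun \<Rightarrow> 'a ae_fun \<Rightarrow> 'a ae_fun" is "\<lambda>f g x. f x - g x"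
  unfolding ae_eq_def by (elim AE_mp) auto

lift_definition uminus_ae_fun :: "'a ae_fun \<Rightarrow> 'a ae_fun" is "\<lambda>f x. - f x"
  unfolding ae_eq_def by (elim AE_mp) auto

lift_definition scaleR_ae_fun :: "real \<Rightarrow> 'a ae_fun \<Rightarrow> 'a ae_fun" is "\<lambda>c f x. c * f x"
  unfolding ae_eq_def by (elim AE_mp) auto

instance
  by standard (transfer; simp add: ae_eq_def algebra_simps)+

end

text \<open>A representative of the class; the values and integrals below do not depend on its choice.\<close>

abbreviation rep :: "'a::euclidean_space ae_fun \<Rightarrow> 'a \<Rightarrow> real" where
  "rep \<equiv> rep_ae_fun"

definition restr :: "'a::euclidean_space set \<Rightarrow> ('a \<Rightarrow> real) \<Rightarrow> 'a ae_fun" where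
  "restr \<Omega> f = abs_ae_fun (\<lambda>x. if x \<in> \<Omega> then f x else 0)"

section \<open>Sobolev spaces\<close>

definition L2 :: "'a::euclidean_space set \<Rightarrow> 'a ae_fun set" where
  "L2 \<Omega> = {f. rep f \<in> borel_measurable lebesgue \<and> integrable lebesgue (\<lambda>x. (rep f x)\<^sup>2) \<and>
     (AE x in lebesgue. x \<notin> \<Omega> \<longrightarrow> rep f x = 0)}"

definition L2_inner :: "'a::euclidean_space set \<Rightarrow> 'a ae_fun \<Rightarrow> 'a ae_fun \<Rightarrow> real" where
  "L2_inner \<Omega> f g = (LINT x:\<Omega>|lebesgue. rep f x * rep g x)"

definition L2_norm :: "'a::euclidean_space set \<Rightarrow> 'a ae_fun \<Rightarrow> real" where
  "L2_norm \<Omega> f = sqrt (L2_inner \<Omega> f f)"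

definition partial :: "'a \<Rightarrow> ('a::euclidean_space \<Rightarrow> real) \<Rightarrow> 'a \<Rightarrow> real" where
  "partial i f = (\<lambda>x. frechet_derivative f (at x) i)"

primrec Ck :: "nat \<Rightarrow> ('a::euclidean_space \<Rightarrow> real) \<Rightarrow> bool" where
  "Ck 0 f \<longleftrightarrow> continuous_on UNIV f"
| "Ck (Suc k) f \<longleftrightarrow> (\<forall>x. f differentiable (at x)) \<and> (\<forall>i\<in>Basis. Ck k (partial i f))"

definition smooth :: "('a::euclidean_space \<Rightarrow> real) \<Rightarrow> bool" where
  "smooth f \<longleftrightarrow> (\<forall>k. Ck k f)"

definition test_fun :: "'a::euclidean_space set \<Rightarrow> ('a \<Rightarrow> real) \<Rightarrow> bool" where
  "test_fun \<Omega> f \<longleftrightarrow> smooth f \<and> compact (closure {x. f x \<noteq> 0}) \<and> closure {x. f x \<noteq> 0} \<subseteq> \<Omega>"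

definition has_weak_deriv ::
    "'a::euclidean_space set \<Rightarrow> 'a \<Rightarrow> 'a ae_fun \<Rightarrow> 'a ae_fun \<Rightarrow> bool" where
  "has_weak_deriv \<Omega> i f g \<longleftrightarrow> (\<forall>\<phi>. test_fun \<Omega> \<phi> \<longrightarrow>
     (LINT x:\<Omega>|lebesgue. rep f x * partial i \<phi> x) = - (LINT x:\<Omega>|lebesgue. rep g x * \<phi> x))"

definition H1 :: "'a::euclidean_space set \<Rightarrow> 'a ae_fun set" where
  "H1 \<Omega> = {f \<in> L2 \<Omega>. \<forall>i\<in>Basis. \<exists>g\<in>L2 \<Omega>. has_weak_deriv \<Omega> i f g}"

definition weak_deriv :: "'a::euclidean_space set \<Rightarrow> 'a \<Rightarrow> 'a ae_fun \<Rightarrow> 'a ae_fun" where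
  "weak_deriv \<Omega> i f = (THE g. g \<in> L2 \<Omega> \<and> has_weak_deriv \<Omega> i f g)"

definition H1_norm :: "'a::euclidean_space set \<Rightarrow> 'a ae_fun \<Rightarrow> real" where
  "H1_norm \<Omega> f = sqrt ((L2_norm \<Omega> f)\<^sup>2 + (\<Sum>i\<in>Basis. (L2_norm \<Omega> (weak_deriv \<Omega> i f))\<^sup>2))"

text \<open>A part of the boundary is given by the set \<open>\<Gamma>\<close> of the surface measures of its sides.
  The trace operator is the continuous extension, from the restrictions of smooth functions
  (which are dense in \<open>H1 \<Omega>\<close> for Lipschitz \<open>\<Omega>\<close>), of the pointwise restriction
  to the boundary, with values in the \<open>L\<^sup>2\<close> space of the boundary;
  \<open>has_trace \<Omega> \<Gamma> f g\<close> says that \<open>f = g\<close> on this part of the boundary in the sense of traces.\<close>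

definition has_trace ::
    "'a::euclidean_space set \<Rightarrow> 'a measure set \<Rightarrow> 'a ae_fun \<Rightarrow> ('a \<Rightarrow> real) \<Rightarrow> bool" where
  "has_trace \<Omega> \<Gamma> f g \<longleftrightarrow> f \<in> H1 \<Omega> \<and> (\<exists>\<phi> :: nat \<Rightarrow> 'a \<Rightarrow> real. (\<forall>k. smooth (\<phi> k)) \<and>
     (\<lambda>k. H1_norm \<Omega> (restr \<Omega> (\<phi> k) - f)) \<longlonglongrightarrow> 0 \<and>
     (\<forall>S\<in>\<Gamma>. (\<lambda>k. \<integral>\<^sup>+x. ennreal ((\<phi> k x - g x)\<^sup>2) \<partial>S) \<longlonglongrightarrow> 0))"

definition H1_D :: "'a::euclidean_space set \<Rightarrow> 'a measure set \<Rightarrow> 'a ae_fun set" where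
  "H1_D \<Omega> \<Gamma> = {f \<in> H1 \<Omega>. has_trace \<Omega> \<Gamma> f (\<lambda>x. 0)}"

section \<open>Hilbert spaces, duals and stability constants\<close>

definition ip_norm :: "('v \<Rightarrow> 'v \<Rightarrow> real) \<Rightarrow> 'v \<Rightarrow> real" where
  "ip_norm ip v = sqrt (ip v v)"

definition hilbert_on :: "'v::real_vector set \<Rightarrow> ('v \<Rightarrow> 'v \<Rightarrow> real) \<Rightarrow> bool" where
  "hilbert_on V ip \<longleftrightarrow> subspace V \<and>
     (\<forall>u\<in>V. \<forall>v\<in>V. ip u v = ip v u) \<and>
     (\<forall>u\<in>V. \<forall>v\<in>V. \<forall>w\<in>V. ip (u + v) w = ip u w + ip v w) \<and>
     (\<forall>c. \<forall>u\<in>V. \<forall>v\<in>V. ip (c *\<^sub>R u) v = c * ip u v) \<and>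
     (\<forall>u\<in>V. u \<noteq> 0 \<longrightarrow> 0 < ip u u) \<and>
     (\<forall>s. (\<forall>k. s k \<in> V) \<and>
          (\<forall>e>0. \<exists>N. \<forall>m\<ge>N. \<forall>n\<ge>N. ip_norm ip (s m - s n) < e) \<longrightarrow>
          (\<exists>l\<in>V. (\<lambda>k. ip_norm ip (s k - l)) \<longlonglongrightarrow> 0))"

text \<open>Functionals on \<open>V\<close> are extended by zero outside \<open>V\<close>, so that equality in the dual is
  HOL equality.\<close>

definition dual :: "'v::real_vector set \<Rightarrow> ('v \<Rightarrow> 'v \<Rightarrow> real) \<Rightarrow> ('v \<Rightarrow> real) set" where
  "dual V ip = {\<eta>. (\<forall>u\<in>V. \<forall>v\<in>V. \<eta> (u + v) = \<eta> u + \<eta> v) \<and>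
     (\<forall>c. \<forall>v\<in>V. \<eta> (c *\<^sub>R v) = c * \<eta> v) \<and>
     (\<exists>C. \<forall>v\<in>V. \<bar>\<eta> v\<bar> \<le> C * ip_norm ip v) \<and> (\<forall>v. v \<notin> V \<longrightarrow> \<eta> v = 0)}"

definition dual_norm :: "'v set \<Rightarrow> ('v \<Rightarrow> 'v \<Rightarrow> real) \<Rightarrow> ('v \<Rightarrow> real) \<Rightarrow> real" where
  "dual_norm V ip \<eta> = (SUP v\<in>{v \<in> V. ip_norm ip v \<le> 1}. \<bar>\<eta> v\<bar>)"

definition pairing :: "('v \<Rightarrow> real) \<Rightarrow> 'v \<Rightarrow> real" where
  "pairing \<eta> v = \<eta> v"

text \<open>The constants are extended reals, because suprema and infima in \<open>real\<close> are
  unspecified for unbounded sets.\<close>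

definition coercivity_const ::
    "'v::zero set \<Rightarrow> ('v \<Rightarrow> 'v \<Rightarrow> real) \<Rightarrow> ('v \<Rightarrow> 'v \<Rightarrow> real) \<Rightarrow> ereal" where
  "coercivity_const V ip a = (INF u\<in>V - {0}. ereal (a u u / (ip_norm ip u)\<^sup>2))"

definition continuity_const ::
    "'v::zero set \<Rightarrow> ('v \<Rightarrow> 'v \<Rightarrow> real) \<Rightarrow> ('v \<Rightarrow> 'v \<Rightarrow> real) \<Rightarrow> ereal" where
  "continuity_const V ip a =
     (SUP u\<in>V - {0}. SUP v\<in>V - {0}. ereal (a u v / (ip_norm ip u * ip_norm ip v)))"

text \<open>Inf-sup constant of the pairing on subspaces \<open>X\<close> of the dual of \<open>V\<close> and \<open>Y\<close> of \<open>V\<close>;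
  the norms are those of the dual of \<open>V\<close> and of \<open>V\<close>.\<close>

definition infsup_const ::
    "'v::zero set \<Rightarrow> ('v \<Rightarrow> 'v \<Rightarrow> real) \<Rightarrow> ('v \<Rightarrow> real) set \<Rightarrow> 'v set \<Rightarrow> ereal" where
  "infsup_const V ip X Y = (INF \<eta>\<in>X - {\<lambda>_. 0}. SUP v\<in>Y - {0}.
     ereal (pairing \<eta> v / (dual_norm V ip \<eta> * ip_norm ip v)))"

definition closed_convex_cone ::
    "'v::real_vector set \<Rightarrow> ('v \<Rightarrow> 'v \<Rightarrow> real) \<Rightarrow> ('v \<Rightarrow> real) set \<Rightarrow> bool" where
  "closed_convex_cone V ip M \<longleftrightarrow> M \<subseteq> dual V ip \<and> M \<noteq> {} \<and>
     (\<forall>\<eta>\<in>M. \<forall>c\<ge>0. (\<lambda>v. c * \<eta> v) \<in> M) \<and>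
     (\<forall>\<eta>\<in>M. \<forall>\<zeta>\<in>M. (\<lambda>v. \<eta> v + \<zeta> v) \<in> M) \<and>
     (\<forall>s. \<forall>\<eta>\<in>dual V ip. (\<forall>k. s k \<in> M) \<and> (\<lambda>k. dual_norm V ip (s k - \<eta>)) \<longlonglongrightarrow> 0 \<longrightarrow> \<eta> \<in> M)"

definition lincomb :: "(nat \<Rightarrow> 'v \<Rightarrow> real) \<Rightarrow> nat \<Rightarrow> (nat \<Rightarrow> real) \<Rightarrow> 'v \<Rightarrow> real" where
  "lincomb \<xi> N \<alpha> = (\<lambda>v. \<Sum>j\<in>{1..N}. \<alpha> j * \<xi> j v)"

definition fun_span :: "(nat \<Rightarrow> 'v \<Rightarrow> real) \<Rightarrow> nat \<Rightarrow> ('v \<Rightarrow> real) set" where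
  "fun_span \<xi> N = {lincomb \<xi> N \<alpha> | \<alpha>. True}"

definition fun_cone :: "(nat \<Rightarrow> 'v \<Rightarrow> real) \<Rightarrow> nat \<Rightarrow> ('v \<Rightarrow> real) set" where
  "fun_cone \<xi> N = {lincomb \<xi> N \<alpha> | \<alpha>. \<forall>j\<in>{1..N}. 0 \<le> \<alpha> j}"

definition fun_independent :: "(nat \<Rightarrow> 'v \<Rightarrow> real) \<Rightarrow> nat \<Rightarrow> bool" where
  "fun_independent \<xi> N \<longleftrightarrow> (\<forall>\<alpha>. lincomb \<xi> N \<alpha> = (\<lambda>_. 0) \<longrightarrow> (\<forall>j\<in>{1..N}. \<alpha> j = 0))"

section \<open>The two option pricing models\<close>

definition interval_ends :: "real \<Rightarrow> real \<Rightarrow> real measure set" where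
  "interval_ends xmin xmax = {count_space {xmin}, count_space {xmax}}"

text \<open>Points of the Heston domain are pairs \<open>(v, x)\<close>. The sides are \<open>v = vmin\<close>,
  \<open>x = xmin\<close> and \<open>x = xmax\<close>, each with its length measure.\<close>

definition rectangle_sides :: "real \<Rightarrow> real \<Rightarrow> real \<Rightarrow> real \<Rightarrow> (real \<times> real) measure set" where
  "rectangle_sides vmin vmax xmin xmax =
     {distr (restrict_space lborel {xmin..xmax}) borel (\<lambda>x. (vmin, x)),
      distr (restrict_space lborel {vmin..vmax}) borel (\<lambda>v. (v, xmin)),
      distr (restrict_space lborel {vmin..vmax}) borel (\<lambda>v. (v, xmax))}"

definition payoff :: "real \<Rightarrow> real \<Rightarrow> real" where
  "payoff K x = max 0 (K - K * exp x)"

fun black_scholes_form ::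
    "real set \<Rightarrow> real \<times> real \<times> real \<Rightarrow> real ae_fun \<Rightarrow> real ae_fun \<Rightarrow> real" where
  "black_scholes_form \<Omega> (\<sigma>, q, r) w \<phi> =
     1/2 * \<sigma>\<^sup>2 * L2_inner \<Omega> (weak_deriv \<Omega> 1 w) (weak_deriv \<Omega> 1 \<phi>)
     - (r - q) * L2_inner \<Omega> (weak_deriv \<Omega> 1 w) \<phi>
     + r * L2_inner \<Omega> w \<phi>"

fun heston_form ::
    "(real \<times> real) set \<Rightarrow> real \<times> real \<times> real \<times> real \<times> real \<Rightarrow>
     (real \<times> real) ae_fun \<Rightarrow> (real \<times> real) ae_fun \<Rightarrow> real" where
  "heston_form \<Omega> (\<xi>, \<rho>, \<gamma>, \<kappa>, r) w \<phi> =
     (let dv = (\<lambda>f. rep (weak_deriv \<Omega> (1, 0) f)); dx = (\<lambda>f. rep (weak_deriv \<Omega> (0, 1) f)) in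
       (LINT p:\<Omega>|lebesgue.
          1/2 * fst p * (\<xi>\<^sup>2 * dv w p + \<rho> * \<xi> * dx w p) * dv \<phi> p
          + 1/2 * fst p * (\<rho> * \<xi> * dv w p + dx w p) * dx \<phi> p)
       + (LINT p:\<Omega>|lebesgue.
          ((- \<kappa> * (\<gamma> - fst p) + 1/2 * \<xi>\<^sup>2) * dv w p
           + (- r + 1/2 * fst p + 1/2 * \<xi> * \<rho>) * dx w p) * rep \<phi> p)
       + r * L2_inner \<Omega> w \<phi>)"

section \<open>The detailed and the reduced problem\<close>

definition f_rhs ::
    "'a::euclidean_space set \<Rightarrow> ('a ae_fun \<Rightarrow> 'a ae_fun \<Rightarrow> real) \<Rightarrow> real \<Rightarrow> real \<Rightarrow>
     (nat \<Rightarrow> 'a ae_fun) \<Rightarrow> nat \<Rightarrow> 'a ae_fun \<Rightarrow> real" where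
  "f_rhs \<Omega> a dt \<theta> ug n \<phi> =
     - L2_inner \<Omega> ((1 / dt) *\<^sub>R (ug (Suc n) - ug n)) \<phi>
     - a (\<theta> *\<^sub>R ug (Suc n) + (1 - \<theta>) *\<^sub>R ug n) \<phi>"

definition g_rhs ::
    "'a::euclidean_space set \<Rightarrow> ('a \<Rightarrow> real) \<Rightarrow> (nat \<Rightarrow> 'a ae_fun) \<Rightarrow> nat \<Rightarrow>
     ('a ae_fun \<Rightarrow> real) \<Rightarrow> real" where
  "g_rhs \<Omega> w0 ug n \<eta> = pairing \<eta> (restr \<Omega> w0 - ug (Suc n))"

text \<open>The \<open>L\<close> time steps over a trial and test space \<open>X\<close> and a cone \<open>C\<close>, which are
  \<open>(V, M)\<close> in the detailed and \<open>(V\<^sub>N, M\<^sub>N)\<close> in the reduced problem. The multiplier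
  \<open>lam 0\<close> is not used.\<close>

definition time_steps ::
    "'a::euclidean_space set \<Rightarrow> ('a \<Rightarrow> real) \<Rightarrow> ('a ae_fun \<Rightarrow> 'a ae_fun \<Rightarrow> real) \<Rightarrow>
     real \<Rightarrow> nat \<Rightarrow> real \<Rightarrow> (nat \<Rightarrow> 'a ae_fun) \<Rightarrow> 'a ae_fun set \<Rightarrow> ('a ae_fun \<Rightarrow> real) set \<Rightarrow>
     (nat \<Rightarrow> 'a ae_fun) \<Rightarrow> (nat \<Rightarrow> 'a ae_fun \<Rightarrow> real) \<Rightarrow> bool" where
  "time_steps \<Omega> w0 a T L \<theta> ug X C u lam \<longleftrightarrow> (let dt = T / real L in
     \<forall>n<L. u (Suc n) \<in> X \<and> lam (Suc n) \<in> C \<and>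
       (\<forall>\<phi>\<in>X. L2_inner \<Omega> ((1 / dt) *\<^sub>R (u (Suc n) - u n)) \<phi>
               + a (\<theta> *\<^sub>R u (Suc n) + (1 - \<theta>) *\<^sub>R u n) \<phi> - pairing (lam (Suc n)) \<phi>
             = f_rhs \<Omega> a dt \<theta> ug n \<phi>) \<and>
       (\<forall>\<eta>\<in>C. pairing (\<eta> - lam (Suc n)) (u (Suc n)) \<ge> g_rhs \<Omega> w0 ug n (\<eta> - lam (Suc n))))"

definition detailed_solution where
  "detailed_solution \<Omega> w0 a T L \<theta> ug V M u lam \<longleftrightarrow>
     u 0 \<in> V \<and> time_steps \<Omega> w0 a T L \<theta> ug V M u lam"

definition reduced_solution where
  "reduced_solution \<Omega> w0 a T L \<theta> ug ip VN MN u0 uN lamN \<longleftrightarrow>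
     uN 0 \<in> VN \<and> (\<forall>v\<in>VN. ip (uN 0 - u0) v = 0) \<and>
     time_steps \<Omega> w0 a T L \<theta> ug VN MN uN lamN"

text \<open>Standing assumptions. The inner product \<open>ip\<close> of \<open>V\<close> and the cone \<open>M\<close> are arbitrary,
  and \<open>a \<mu>\<close> is the bilinear form with parameter \<open>\<mu>\<close>.\<close>

locale reduced_basis_setting =
  fixes \<Omega> :: "'a::euclidean_space set"
    and \<Gamma> :: "'a measure set"
    and w0 :: "'a \<Rightarrow> real"
    and P :: "'p set"
    and a :: "'p \<Rightarrow> 'a ae_fun \<Rightarrow> 'a ae_fun \<Rightarrow> real"
    and T :: real and L :: nat and \<theta> :: real
    and ug :: "nat \<Rightarrow> 'a ae_fun"
    and V :: "'a ae_fun set"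
    and ip :: "'a ae_fun \<Rightarrow> 'a ae_fun \<Rightarrow> real"
    and M :: "('a ae_fun \<Rightarrow> real) set"
    and NV :: nat and \<psi> :: "nat \<Rightarrow> 'a ae_fun"
    and NW :: nat and \<xi> :: "nat \<Rightarrow> 'a ae_fun \<Rightarrow> real"
  assumes V_eq: "V = H1_D \<Omega> \<Gamma>"
    and V_hilbert: "hilbert_on V ip"
    and V_embedding: "\<exists>C. \<forall>v\<in>V. L2_norm \<Omega> v \<le> C * ip_norm ip v"
    and M_cone: "closed_convex_cone V ip M"
    and a_coercive: "\<And>\<mu>. \<mu> \<in> P \<Longrightarrow> 0 < coercivity_const V ip (a \<mu>)"
    and a_continuous: "\<And>\<mu>. \<mu> \<in> P \<Longrightarrow> continuity_const V ip (a \<mu>) < \<infinity>"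
    and b_infsup: "0 < infsup_const V ip (dual V ip) V"
    and time: "0 < T" "0 < L" "0 \<le> \<theta>" "\<theta> \<le> 1"
    and lift: "\<And>n. n \<le> L \<Longrightarrow> ug n \<in> H1 \<Omega> \<and> has_trace \<Omega> \<Gamma> (ug n) w0"
    and primal_basis: "\<psi> ` {1..NV} \<subseteq> V" "inj_on \<psi> {1..NV}" "independent (\<psi> ` {1..NV})"
    and dual_basis: "\<xi> ` {1..NW} \<subseteq> M" "fun_independent \<xi> NW"
    and reduced_infsup: "infsup_const V ip (dual V ip) V
      \<le> infsup_const V ip (fun_span \<xi> NW) (span (\<psi> ` {1..NV}))"

end

theory Submission
  imports Defs "HOL-Real_Asymp.Real_Asymp"
begin

text \<open>A detailed solution that stays in the reduced spaces solves the reduced problem, because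
  \<open>V\<^sub>N \<subseteq> V\<close> and \<open>M\<^sub>N \<subseteq> M\<close>; the claim is thus uniqueness of the reduced solution. The initial values
  agree because a \<open>V\<close>-orthogonal projection fixes the elements of \<open>V\<^sub>N\<close>. In one time step from
  equal values, let \<open>e = u\<^sub>N - u\<close> and \<open>\<delta> = \<lambda>\<^sub>N - \<lambda>\<close>. Adding the two variational inequalities gives
  \<open>b(\<delta>, e) \<le> 0\<close>, and testing the difference of the two equations with \<open>e\<close> gives
  \<open>\<parallel>e\<parallel>\<^sup>2 / \<Delta>t + \<theta> a(e, e) = b(\<delta>, e) \<le> 0\<close>. By coercivity \<open>a(e, e) \<ge> 0\<close>, so \<open>e = 0\<close>; then \<open>b(\<delta>, \<cdot>)\<close> vanishes on \<open>V\<^sub>N\<close>, and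
  \<open>\<delta> = 0\<close> by the reduced inf-sup condition. The lemma \<open>homogeneous_step_trivial\<close> and the theorem
  \<open>reproduction_of_solutions\<close> carry this out for any coercive form that is linear in its first argument.

  The analytic content is the linearity of the two concrete forms. A weak derivative is defined by
  a definite description, so \<open>\<partial>(c f + g) = c \<partial>f + \<partial>g\<close> rests on the uniqueness of weak derivatives, that
  is, on the fundamental lemma of the calculus of variations: an integrable function orthogonal to
  all test functions vanishes almost everywhere. For this, explicit smooth bumps built from
  \<open>exp (-1/t)\<close> approximate the indicators of boxes, and the boxes generate the Borel sets.\<close>

section \<open>Smooth bumps and the fundamental lemma of the calculus of variations\<close>

text \<open>The derivative of \<open>t\<^sup>-\<^sup>m exp (-1/t)\<close> is a linear combination of two functions of the same
  kind, with exponents \<open>m + 2\<close> and \<open>m + 1\<close>. Indexing by \<open>m\<close> therefore makes the family closed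
  under differentiation, and its smoothness needs no formula for higher derivatives.\<close>

definition flat :: "nat \<Rightarrow> real \<Rightarrow> real" where
  "flat m t = (if t \<le> 0 then 0 else exp (- (1 / t)) / t ^ m)"

text \<open>With \<open>s = 1/t\<close> this is \<open>s\<^sup>m\<^sup>+\<^sup>2 \<le> (m + 2)! exp s\<close>, one term of the exponential series. A quadratic
  bound is what makes the derivative at the junction point \<open>0\<close> exist and vanish.\<close>

lemma flat_quadratic_bound: "\<exists>C. \<forall>t. \<bar>flat m t\<bar> \<le> C * t\<^sup>2"
proof (intro exI allI)
  fix t :: real
  show "\<bar>flat m t\<bar> \<le> fact (m + 2) * t\<^sup>2"
  proof (cases "t \<le> 0")
    case False
    define s where "s = 1 / t"
    have "s > 0" using False by (simp add: s_def)
    have "(\<Sum>k\<in>{m+2}. inverse (fact k) *\<^sub>R s ^ k) \<le> (\<Sum>k. inverse (fact k) *\<^sub>R s ^ k)"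
      using \<open>s > 0\<close> by (intro sum_le_suminf summable_exp_generic) auto
    then have "s ^ (m + 2) / fact (m + 2) \<le> exp s"
      by (simp only: exp_def) (simp add: divide_inverse_commute)
    then have "s ^ (m + 2) \<le> exp s * fact (m + 2)"
      by (simp only: pos_divide_le_eq[OF fact_gt_zero])
    then have "s ^ (m + 2) * exp (- s) \<le> fact (m + 2)"
      by (simp only: exp_minus divide_inverse[symmetric] pos_divide_le_eq[OF exp_gt_zero] mult.commute[of "exp s"])
    then have "(s ^ m * exp (- s)) * s\<^sup>2 \<le> fact (m + 2)"
      by (simp only: power_add mult_ac)
    then have "(s ^ m * exp (- s)) \<le> fact (m + 2) * t\<^sup>2"
      using False by (simp add: s_def field_simps)
    then show ?thesis
      using False by (simp add: flat_def s_def power_one_over power_inverse divide_inverse mult_ac)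
  qed (simp add: flat_def)
qed

lemma DERIV_flat: "DERIV (flat m) t :> flat (m + 2) t - real m * flat (m + 1) t"
proof -
  consider "t < 0" | "t = 0" | "t > 0" by linarith
  then show ?thesis
  proof cases
    case 1
    have "DERIV (\<lambda>_. 0 :: real) t :> 0" by simp
    then have "DERIV (flat m) t :> 0"
      by (rule DERIV_cong_ev[THEN iffD1, rotated -1])
         (use 1 in \<open>auto simp: flat_def intro!: eventually_mono[OF eventually_nhds_in_open[of "{..<0}"]]\<close>)
    then show ?thesis using 1 by (simp add: flat_def)
  next
    case 2
    obtain C where C: "\<And>t. \<bar>flat m t\<bar> \<le> C * t\<^sup>2" using flat_quadratic_bound by blast
    have "(\<lambda>h. flat m h / h) \<midarrow>0\<rightarrow> 0"
    proof (rule Lim_null_comparison[where g = "\<lambda>h. C * \<bar>h\<bar>"])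
      have "norm (flat m h / h) \<le> C * \<bar>h\<bar>" if "h \<noteq> 0" for h
        using C[of h] that by (simp add: field_simps power2_eq_square flip: abs_mult)
      then show "\<forall>\<^sub>F h in at 0. norm (flat m h / h) \<le> C * \<bar>h\<bar>"
        by (simp add: eventually_at_filter)
      show "(\<lambda>h. C * \<bar>h\<bar>) \<midarrow>0\<rightarrow> 0" by (auto intro!: tendsto_eq_intros)
    qed
    then show ?thesis using 2 by (simp add: DERIV_def flat_def)
  next
    case 3
    let ?D = "(1 / t\<^sup>2 * exp (- (1 / t)) * t ^ m - exp (- (1 / t)) * (real m * t ^ (m - 1))) / (t ^ m * t ^ m)"
    have "?D = flat (m + 2) t - real m * flat (m + 1) t"
      using 3 by (cases m) (auto simp: flat_def field_simps power2_eq_square power_add)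
    moreover have "DERIV (\<lambda>t. exp (- (1 / t)) / t ^ m) t :> ?D"
      using 3 by (auto intro!: derivative_eq_intros simp: power2_eq_square)
    ultimately have "DERIV (\<lambda>t. exp (- (1 / t)) / t ^ m) t :> flat (m + 2) t - real m * flat (m + 1) t"
      by simp
    then show ?thesis
      by (rule DERIV_cong_ev[THEN iffD1, rotated -1])
         (use 3 in \<open>auto simp: flat_def intro!: eventually_mono[OF eventually_nhds_in_open[of "{0<..}"]]\<close>)
  qed
qed

text \<open>An algebra of functions of several variables that contains the bumps and is closed under partial
  derivatives: by the product rule it suffices that the derivatives of the generators belong to it.\<close>

inductive flat_algebra :: "('a::euclidean_space \<Rightarrow> real) \<Rightarrow> bool" where
  const: "flat_algebra (\<lambda>x. c)"
| flat: "flat_algebra (\<lambda>x. flat m (r * (x \<bullet> i) + s))"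
| add: "flat_algebra f \<Longrightarrow> flat_algebra g \<Longrightarrow> flat_algebra (\<lambda>x. f x + g x)"
| mult: "flat_algebra f \<Longrightarrow> flat_algebra g \<Longrightarrow> flat_algebra (\<lambda>x. f x * g x)"

lemma flat_algebra_prod:
  assumes "finite I" "\<And>i. i \<in> I \<Longrightarrow> flat_algebra (f i)"
  shows "flat_algebra (\<lambda>x. \<Prod>i\<in>I. f i x)"
  using assms by (induction rule: finite_induct) (auto intro: flat_algebra.intros)

lemma flat_algebra_derivative:
  assumes "flat_algebra f"
  shows "\<exists>f'. (\<forall>x. (f has_derivative f' x) (at x)) \<and> (\<forall>j. flat_algebra (\<lambda>x. f' x j))"
  using assms
proof induction
  case (const c)
  show ?case by (rule exI[of _ "\<lambda>x h. 0"]) (auto intro: flat_algebra.const)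
next
  case (flat m r i s)
  let ?a = "\<lambda>x. r * (x \<bullet> i) + s"
  have 1: "((\<lambda>x. flat m (?a x)) has_derivative
      (\<lambda>h. (r * (h \<bullet> i)) * (flat (m + 2) (?a x) + - real m * flat (m + 1) (?a x)))) (at x)" for x
  proof -
    have "(?a has_derivative (\<lambda>h. r * (h \<bullet> i))) (at x)"
      by (auto intro!: derivative_eq_intros)
    from has_derivative_compose[OF this DERIV_flat[of m "?a x", unfolded has_field_derivative_def]]
    show ?thesis by (simp add: mult_ac)
  qed
  show ?case
    by (rule exI[of _ "\<lambda>x h. (r * (h \<bullet> i)) * (flat (m + 2) (?a x) + - real m * flat (m + 1) (?a x))"])
       (intro conjI allI 1 flat_algebra.intros)
next
  case (add f g)
  then obtain f' g' where "\<forall>x. (f has_derivative f' x) (at x)" "\<forall>j. flat_algebra (\<lambda>x. f' x j)"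
    "\<forall>x. (g has_derivative g' x) (at x)" "\<forall>j. flat_algebra (\<lambda>x. g' x j)" by blast
  then show ?case
    by (intro exI[of _ "\<lambda>x h. f' x h + g' x h"]) (auto intro: flat_algebra.add has_derivative_add)
next
  case (mult f g)
  then obtain f' g' where "\<forall>x. (f has_derivative f' x) (at x)" "\<forall>j. flat_algebra (\<lambda>x. f' x j)"
    "\<forall>x. (g has_derivative g' x) (at x)" "\<forall>j. flat_algebra (\<lambda>x. g' x j)" by blast
  with mult.hyps show ?case
    by (intro exI[of _ "\<lambda>x h. f x * g' x h + f' x h * g x"])
       (auto intro!: flat_algebra.add flat_algebra.mult has_derivative_mult)
qed

text \<open>Differentiable functions are continuous, so closure under partial derivatives gives continuous
  derivatives of every order.\<close>

lemma smooth_flat_algebra: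
  assumes "flat_algebra f"
  shows "smooth f"
proof -
  have "Ck k f" if "flat_algebra f" for k and f :: "'a \<Rightarrow> real"
    using that
  proof (induction k arbitrary: f)
    case 0
    then show ?case
      using flat_algebra_derivative[OF 0]
      by (auto simp: continuous_on_eq_continuous_at intro: has_derivative_continuous)
  next
    case (Suc k)
    obtain f' where f': "\<forall>x. (f has_derivative f' x) (at x)" "\<forall>j. flat_algebra (\<lambda>x. f' x j)"
      using flat_algebra_derivative[OF Suc.prems] by blast
    have "partial j f = (\<lambda>x. f' x j)" for j
      unfolding partial_def using f'(1) frechet_derivative_at by metis
    then show ?case using f' Suc.IH by (auto simp: differentiable_def)
  qed
  with assms show ?thesis by (simp add: smooth_def)
qed

text \<open>The offset \<open>-1\<close> keeps the support at distance \<open>1/k\<close> from the boundary of the box, while the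
  factor \<open>k\<close> sends the arguments to infinity inside the box, where \<open>flat 0\<close> tends to \<open>1\<close>.\<close>

definition box_bump :: "'a::euclidean_space \<Rightarrow> 'a \<Rightarrow> nat \<Rightarrow> 'a \<Rightarrow> real" where
  "box_bump c d k x =
    (\<Prod>i\<in>Basis. flat 0 (real k * ((x - c) \<bullet> i) - 1) * flat 0 (real k * ((d - x) \<bullet> i) - 1))"

lemma box_bump_bounds: "0 \<le> box_bump c d k x" "box_bump c d k x \<le> 1"
proof -
  have *: "0 \<le> flat 0 t" "flat 0 t \<le> 1" for t by (auto simp: flat_def)
  show "0 \<le> box_bump c d k x" unfolding box_bump_def by (intro prod_nonneg mult_nonneg_nonneg ballI *)
  show "box_bump c d k x \<le> 1" unfolding box_bump_def
    by (intro prod_le_1 conjI mult_nonneg_nonneg mult_le_one ballI *)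
qed

lemma test_fun_box_bump:
  assumes "0 < k"
  shows "test_fun (box c d) (box_bump c d k)"
proof -
  have "flat_algebra (box_bump c d k)"
  proof -
    have "box_bump c d k = (\<lambda>x. \<Prod>i\<in>Basis. flat 0 (real k * (x \<bullet> i) + (- real k * (c \<bullet> i) - 1))
        * flat 0 (- real k * (x \<bullet> i) + (real k * (d \<bullet> i) - 1)))"
      by (simp add: box_bump_def fun_eq_iff inner_diff_left algebra_simps)
    then show ?thesis
      by (simp only:) (intro flat_algebra_prod flat_algebra.mult flat_algebra.flat finite_Basis)
  qed
  let ?S = "{x. box_bump c d k x \<noteq> 0}"
  let ?Q = "cbox (c + (1 / real k) *\<^sub>R One) (d - (1 / real k) *\<^sub>R One)"
  have "?S \<subseteq> ?Q"
  proof
    fix x assume "x \<in> ?S"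
    then have "0 < real k * ((x - c) \<bullet> i) - 1" "0 < real k * ((d - x) \<bullet> i) - 1" if "i \<in> Basis" for i
      using that by (auto simp: box_bump_def flat_def split: if_splits)
    then show "x \<in> ?Q"
      using assms by (simp add: mem_box inner_diff_left inner_add_left field_simps less_imp_le)
  qed
  then have "closure ?S \<subseteq> ?Q" by (rule closure_minimal) (rule closed_cbox)
  moreover have "?Q \<subseteq> box c d"
  proof
    fix x assume x: "x \<in> ?Q"
    have "c \<bullet> i < x \<bullet> i \<and> x \<bullet> i < d \<bullet> i" if "i \<in> Basis" for i
    proof -
      have "c \<bullet> i + 1 / real k \<le> x \<bullet> i" "x \<bullet> i \<le> d \<bullet> i - 1 / real k"
        using x that by (auto simp: mem_box inner_diff_left inner_add_left)
      moreover have "0 < 1 / real k" using assms by simp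
      ultimately show ?thesis by linarith
    qed
    then show "x \<in> box c d" by (simp add: mem_box)
  qed
  moreover have "compact (closure ?S)"
    using bounded_subset[OF bounded_cbox \<open>?S \<subseteq> ?Q\<close>] by (simp add: compact_closure)
  ultimately show ?thesis
    using smooth_flat_algebra[OF \<open>flat_algebra _\<close>] by (auto simp: test_fun_def)
qed

lemma box_bump_tendsto_indicator: "(\<lambda>k. box_bump c d k x) \<longlonglongrightarrow> indicator (box c d) x"
proof (cases "x \<in> box c d")
  case True
  have flat_lim: "(\<lambda>k. flat 0 (real k * t - 1)) \<longlonglongrightarrow> 1" if "0 < t" for t
  proof -
    have lim: "(\<lambda>k. exp (- (1 / (real k * t - 1)))) \<longlonglongrightarrow> 1"
      using that by real_asymp
    have "\<forall>\<^sub>F k in sequentially. 0 < real k * t - 1"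
      using that by real_asymp
    then have "\<forall>\<^sub>F k in sequentially. exp (- (1 / (real k * t - 1))) = flat 0 (real k * t - 1)"
      by eventually_elim (simp add: flat_def)
    from Lim_transform_eventually[OF lim this] show ?thesis .
  qed
  have "(\<lambda>k. box_bump c d k x) \<longlonglongrightarrow> (\<Prod>i\<in>(Basis::'a set). 1 * 1)"
    unfolding box_bump_def
    using True by (intro tendsto_prod tendsto_mult flat_lim) (auto simp: mem_box inner_diff_left)
  with True show ?thesis by simp
next
  case False
  then obtain i where i: "i \<in> Basis" "(x - c) \<bullet> i \<le> 0 \<or> (d - x) \<bullet> i \<le> 0"
    by (auto simp: mem_box inner_diff_left not_less)
  have "box_bump c d k x = 0" for k
  proof -
    have "real k * ((x - c) \<bullet> i) - 1 \<le> 0 \<or> real k * ((d - x) \<bullet> i) - 1 \<le> 0"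
      using i(2) mult_nonneg_nonpos[of "real k" "(x - c) \<bullet> i"] mult_nonneg_nonpos[of "real k" "(d - x) \<bullet> i"]
      by auto
    then show ?thesis
      using i(1) unfolding box_bump_def by (intro prod_zero) (auto simp: flat_def)
  qed
  with False show ?thesis by simp
qed

lemma continuous_on_Ck: "Ck k f \<Longrightarrow> continuous_on UNIV f"
  by (cases k) (auto simp: continuous_on_eq_continuous_at intro: differentiable_imp_continuous_within)

lemma continuous_on_smooth: "smooth f \<Longrightarrow> continuous_on UNIV f"
  unfolding smooth_def using continuous_on_Ck by blast

lemma continuous_on_partial_smooth:
  assumes "smooth f" "i \<in> Basis"
  shows "continuous_on UNIV (partial i f)"
proof -
  have "Ck (Suc 0) f" using assms(1) unfolding smooth_def by blast
  with assms(2) show ?thesis by simp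
qed

text \<open>The bumps are bounded by \<open>1\<close> and converge to the indicator of the box, so dominated convergence
  replaces the test function by that indicator.\<close>

lemma box_integral_eq_0:
  fixes g :: "'a::euclidean_space \<Rightarrow> real"
  assumes g: "integrable lebesgue g"
    and orth: "\<And>\<phi>. test_fun (box c d) \<phi> \<Longrightarrow> (LINT x|lebesgue. g x * \<phi> x) = 0"
  shows "(LINT x:box c d|lebesgue. g x) = 0"
proof -
  have "(\<lambda>k. LINT x|lebesgue. g x * box_bump c d k x)
      \<longlonglongrightarrow> (LINT x|lebesgue. g x * indicator (box c d) x)"
  proof (rule integral_dominated_convergence[where w = "\<lambda>x. \<bar>g x\<bar>"])
    show "(\<lambda>x. g x * indicator (box c d) x) \<in> borel_measurable lebesgue"
      using g by (intro borel_measurable_times borel_measurable_indicator) auto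
    have "box_bump c d k \<in> borel_measurable lborel" for k
      unfolding box_bump_def flat_def by measurable
    then have "box_bump c d k \<in> borel_measurable lebesgue" for k
      by (rule measurable_completion)
    then show "(\<lambda>x. g x * box_bump c d k x) \<in> borel_measurable lebesgue" for k
      using g by (intro borel_measurable_times) auto
    show "AE x in lebesgue. (\<lambda>k. g x * box_bump c d k x) \<longlonglongrightarrow> g x * indicator (box c d) x"
      by (intro AE_I2 tendsto_intros box_bump_tendsto_indicator)
    show "AE x in lebesgue. norm (g x * box_bump c d k x) \<le> \<bar>g x\<bar>" for k
      using box_bump_bounds[of c d k]
      by (intro AE_I2) (simp add: abs_mult mult_left_le)
  qed (use g in auto)
  moreover have "\<forall>\<^sub>F k in sequentially. (LINT x|lebesgue. g x * box_bump c d k x) = 0"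
    using eventually_gt_at_top[of 0] by eventually_elim (intro orth test_fun_box_bump)
  ultimately have "(LINT x|lebesgue. g x * indicator (box c d) x) = 0"
    by (intro LIMSEQ_unique[OF _ tendsto_eventually])
  then show ?thesis by (simp add: set_lebesgue_integral_def mult.commute)
qed

text \<open>Boxes are stable under intersection and generate the Borel sets; hence the integral of \<open>g\<close>
  vanishes over every Borel set, in particular over those where \<open>g\<close> has a fixed sign. The total
  integral enters in the step to complements.\<close>

lemma AE_eq_0_if_box_integrals_eq_0:
  fixes g :: "'a::euclidean_space \<Rightarrow> real"
  assumes g: "integrable lebesgue g"
    and total: "(LINT x|lebesgue. g x) = 0"
    and box: "\<And>c d. (LINT x:box c d|lebesgue. g x) = 0"
  shows "AE x in lebesgue. g x = 0"
proof -
  obtain g' where g': "g' \<in> borel_measurable lborel" "AE x in lborel. g x = g' x"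
    using completion_ex_borel_measurable_real[of g lborel] g by auto
  have AE': "AE x in lebesgue. g x = g' x" using g'(2) by (rule AE_completion)
  have g'_leb: "g' \<in> borel_measurable lebesgue" using g'(1) by (rule measurable_completion)
  have "integrable lebesgue g'"
    using g AE' g'_leb borel_measurable_integrable[OF g] integrable_cong_AE by blast
  then have int: "integrable lborel g'" using g'(1) by (simp add: integrable_completion)
  have eq: "(LINT x:A|lborel. g' x) = (LINT x:A|lebesgue. g x)" if "A \<in> sets borel" for A
  proof -
    have [measurable]: "A \<in> sets lebesgue" using that by auto
    have "(LINT x:A|lborel. g' x) = (LINT x:A|lebesgue. g' x)"
      unfolding set_lebesgue_integral_def
      using g'(1) that by (intro integral_completion[symmetric] borel_measurable_scaleR) auto
    also have "\<dots> = (LINT x:A|lebesgue. g x)"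
      using AE' g'_leb borel_measurable_integrable[OF g]
      by (intro set_lebesgue_integral_cong_AE) (auto elim: eventually_mono)
    finally show ?thesis .
  qed
  let ?G = "range (\<lambda>(c, d). box c d :: 'a set)"
  have "(LINT x:A|lborel. g' x) = 0" if "A \<in> sets borel" for A
  proof -
    have sub: "?G \<subseteq> Pow UNIV" by simp
    have borel: "sets borel = sigma_sets UNIV ?G"
      unfolding borel_eq_box by (rule sets_measure_of) simp
    have stable: "Int_stable ?G"
      by (auto simp: Int_stable_def box_Int_box)
    have "A \<in> sigma_sets UNIV ?G" using that borel by simp
    with stable sub show ?thesis
    proof (induction rule: sigma_sets_induct_disjoint)
      case (basic A)
      then show ?case using box eq by auto
    next
      case empty
      then show ?case by (simp add: set_lebesgue_integral_def)
    next
      case (compl A)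
      then have A: "A \<in> sets borel" using borel by simp
      have "(LINT x:UNIV|lborel. g' x) = 0"
        using eq[of UNIV] total by (simp add: set_lebesgue_integral_def)
      moreover have "(LINT x:UNIV|lborel. g' x) = (LINT x:(UNIV - A)|lborel. g' x) + (LINT x:A|lborel. g' x)"
      proof -
        have "set_integrable lborel B g'" if "B \<in> sets borel" for B
          unfolding set_integrable_def using int that by (intro integrable_mult_indicator) auto
        then have "(LINT x:(UNIV - A) \<union> A|lborel. g' x)
            = (LINT x:(UNIV - A)|lborel. g' x) + (LINT x:A|lborel. g' x)"
          using A by (intro set_integral_Un) auto
        then show ?thesis by simp
      qed
      ultimately show ?case using compl by simp
    next
      case (union A)
      then have "A i \<in> sets borel" for i using borel by auto
      moreover from this have "set_integrable lborel (\<Union>i. A i) g'"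
        unfolding set_integrable_def using int by (intro integrable_mult_indicator) auto
      ultimately have "(LINT x:(\<Union>i. A i)|lborel. g' x) = (\<Sum>i. LINT x:A i|lborel. g' x)"
        using union(1) by (intro lebesgue_integral_countable_add) (auto simp: disjoint_family_on_def)
      then show ?case using union by simp
    qed
  qed
  then have "AE x in lborel. g' x = 0"
    using int by (intro density_unique_real) (auto simp: set_lebesgue_integral_def)
  then have "AE x in lebesgue. g' x = 0" by (rule AE_completion)
  with AE' show ?thesis by eventually_elim simp
qed

text \<open>On a box inside \<open>\<Omega>\<close> the two preceding lemmas apply to \<open>g\<close> cut off outside the box, since a test
  function of a smaller box is one of \<open>\<Omega>\<close>. Countably many such boxes cover \<open>\<Omega>\<close>.\<close>

lemma fundamental_lemma_of_variations:
  fixes g :: "'a::euclidean_space \<Rightarrow> real"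
  assumes "open \<Omega>" and g: "set_integrable lebesgue \<Omega> g"
    and orth: "\<And>\<phi>. test_fun \<Omega> \<phi> \<Longrightarrow> (LINT x:\<Omega>|lebesgue. g x * \<phi> x) = 0"
  shows "AE x in lebesgue. x \<in> \<Omega> \<longrightarrow> g x = 0"
proof -
  have on_box: "AE x in lebesgue. x \<in> box a b \<longrightarrow> g x = 0" if sub: "box a b \<subseteq> \<Omega>" for a b
  proof -
    define h where "h = (\<lambda>x. indicator (box a b) x * g x)"
    have h: "integrable lebesgue h"
      using set_integrable_subset[OF g _ sub] by (simp add: set_integrable_def h_def)
    have 0: "(LINT x:box c d|lebesgue. h x) = 0" if cd: "box c d \<subseteq> box a b" for c d
    proof (rule box_integral_eq_0[OF h])
      fix \<phi> assume \<phi>: "test_fun (box c d) \<phi>"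
      then have "test_fun \<Omega> \<phi>" using cd sub by (auto simp: test_fun_def)
      then have "(LINT x:\<Omega>|lebesgue. g x * \<phi> x) = 0" by (rule orth)
      moreover have "indicator \<Omega> x * (g x * \<phi> x) = h x * \<phi> x" for x
        using \<phi> cd sub closure_subset[of "{x. \<phi> x \<noteq> 0}"]
        by (cases "\<phi> x = 0") (auto simp: test_fun_def h_def indicator_def)
      ultimately show "(LINT x|lebesgue. h x * \<phi> x) = 0"
        by (simp add: set_lebesgue_integral_def)
    qed
    have "AE x in lebesgue. h x = 0"
    proof (rule AE_eq_0_if_box_integrals_eq_0[OF h])
      \<comment> \<open>The total integral of the cut-off function is one of the integrals over boxes inside \<open>\<Omega>\<close>.\<close>
      have h_eq: "h x = indicator (box a b) x * h x" for x by (simp add: h_def indicator_def)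
      show "(LINT x|lebesgue. h x) = 0"
        using 0[of a b] by (simp add: set_lebesgue_integral_def flip: h_eq)
      fix c d :: 'a
      have "(LINT x:box c d|lebesgue. h x) = (LINT x:box c d \<inter> box a b|lebesgue. h x)"
        unfolding set_lebesgue_integral_def
        by (intro Bochner_Integration.integral_cong) (auto simp: h_def indicator_def)
      also have "\<dots> = 0"
        by (subst box_Int_box, rule 0) (subst box_Int_box[symmetric], simp)
      finally show "(LINT x:box c d|lebesgue. h x) = 0" .
    qed
    then show ?thesis by eventually_elim (simp add: h_def indicator_def split: if_splits)
  qed
  obtain \<D> where \<D>: "countable \<D>" "\<D> \<subseteq> Pow \<Omega>" "\<And>X. X \<in> \<D> \<Longrightarrow> \<exists>a b. X = box a b" "\<Union>\<D> = \<Omega>"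
    using open_countable_Union_open_box[OF \<open>open \<Omega>\<close>] by metis
  have "AE x in lebesgue. \<forall>X\<in>\<D>. x \<in> X \<longrightarrow> g x = 0"
    using \<D>(1)
  proof (rule AE_ball_countable[THEN iffD2, rule_format])
    fix X assume "X \<in> \<D>"
    then show "AE x in lebesgue. x \<in> X \<longrightarrow> g x = 0"
      using \<D>(2,3) on_box by blast
  qed
  then show ?thesis by eventually_elim (use \<D>(4) in blast)
qed

section \<open>Square integrable functions and uniqueness of weak derivatives\<close>
lemma AE_rep_abs: "AE x in lebesgue. rep (abs_ae_fun f) x = f x"
proof -
  have "ae_eq f (rep (abs_ae_fun f))"
    by (rule rep_abs_rsp[OF Quotient3_ae_fun]) (simp add: ae_eq_def)
  then show ?thesis unfolding ae_eq_def by (auto elim: eventually_mono)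
qed

lemma ae_fun_eqI:
  assumes "AE x in lebesgue. rep f x = rep g x"
  shows "f = g"
  using assms Quotient3_rel_rep[OF Quotient3_ae_fun, of f g] by (simp add: ae_eq_def)

lemma AE_rep_zero: "AE x in lebesgue. rep 0 x = 0"
  unfolding zero_ae_fun_def by (rule AE_rep_abs)

text \<open>Representatives are chosen independently in each class, so algebraic identities between them hold
  almost everywhere only. All linearity statements below have the form \<open>c *\<^sub>R f + g\<close>, which covers
  sums, multiples and differences at once.\<close>

lemma AE_rep_lin: "AE x in lebesgue. rep (c *\<^sub>R f + g) x = c * rep f x + rep g x"
proof -
  have abs_rep: "abs_ae_fun (rep h) = h" for h :: "'a ae_fun"
    by (rule Quotient3_abs_rep[OF Quotient3_ae_fun])
  have "c *\<^sub>R f + g = abs_ae_fun (\<lambda>x. c * rep f x + rep g x)"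
    by (metis abs_rep plus_ae_fun.abs_eq scaleR_ae_fun.abs_eq)
  then show ?thesis using AE_rep_abs[of "\<lambda>x. c * rep f x + rep g x"] by simp
qed

lemma L2_D:
  assumes "f \<in> L2 \<Omega>"
  shows "rep f \<in> borel_measurable lebesgue" "integrable lebesgue (\<lambda>x. (rep f x)\<^sup>2)"
    "AE x in lebesgue. x \<notin> \<Omega> \<longrightarrow> rep f x = 0"
  using assms by (auto simp: L2_def)

lemma L2_mult_integrable:
  assumes "f \<in> L2 \<Omega>" "g \<in> L2 \<Omega>"
  shows "integrable lebesgue (\<lambda>x. rep f x * rep g x)"
proof (rule Bochner_Integration.integrable_bound)
  show "integrable lebesgue (\<lambda>x. (rep f x)\<^sup>2 + (rep g x)\<^sup>2)"
    using assms[THEN L2_D(2)] by simp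
  show "(\<lambda>x. rep f x * rep g x) \<in> borel_measurable lebesgue"
    using assms[THEN L2_D(1)] by simp
  have "\<bar>s * t\<bar> \<le> s\<^sup>2 + t\<^sup>2" for s t :: real
  proof -
    have "2 * \<bar>s * t\<bar> \<le> s\<^sup>2 + t\<^sup>2"
      using sum_squares_bound[of "\<bar>s\<bar>" "\<bar>t\<bar>"] by (simp add: abs_mult mult.assoc)
    then show ?thesis using abs_ge_zero[of "s * t"] by linarith
  qed
  then show "AE x in lebesgue. norm (rep f x * rep g x) \<le> norm ((rep f x)\<^sup>2 + (rep g x)\<^sup>2)"
    by (intro AE_I2) (simp add: sum_power2_ge_zero)
qed

lemma borel_measurable_lebesgue_cong_AE:
  fixes f g :: "'a::euclidean_space \<Rightarrow> real"
  assumes "f \<in> borel_measurable lebesgue" "AE x in lebesgue. f x = g x"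
  shows "g \<in> borel_measurable lebesgue"
proof (rule measurableI)
  fix A :: "real set" assume "A \<in> sets borel"
  then have "f -` A \<inter> space lebesgue \<in> sets lebesgue"
    using assms(1) by (rule measurable_sets[rotated])
  moreover have "AE x in lebesgue. x \<in> f -` A \<inter> space lebesgue \<longleftrightarrow> x \<in> g -` A \<inter> space lebesgue"
    using assms(2) by eventually_elim simp
  ultimately show "g -` A \<inter> space lebesgue \<in> sets lebesgue"
    by (intro completion.in_sets_AE[where B = "g -` A \<inter> space lebesgue"]) auto
qed simp

lemma L2_lin:
  assumes f: "f \<in> L2 \<Omega>" and g: "g \<in> L2 \<Omega>"
  shows "c *\<^sub>R f + g \<in> L2 \<Omega>"
proof -
  let ?h = "\<lambda>x. c * rep f x + rep g x"
  have h: "?h \<in> borel_measurable lebesgue" using L2_D(1)[OF f] L2_D(1)[OF g] by simp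
  have meas: "rep (c *\<^sub>R f + g) \<in> borel_measurable lebesgue"
    by (rule borel_measurable_lebesgue_cong_AE[OF h]) (use AE_rep_lin[of c f g] in eventually_elim, simp)
  have "integrable lebesgue (\<lambda>x. c\<^sup>2 * (rep f x)\<^sup>2 + 2 * c * (rep f x * rep g x) + (rep g x)\<^sup>2)"
    using L2_D(2)[OF f] L2_D(2)[OF g] L2_mult_integrable[OF f g] by simp
  moreover have "AE x in lebesgue. c\<^sup>2 * (rep f x)\<^sup>2 + 2 * c * (rep f x * rep g x) + (rep g x)\<^sup>2
      = (rep (c *\<^sub>R f + g) x)\<^sup>2"
    using AE_rep_lin[of c f g] by eventually_elim (simp add: power2_eq_square algebra_simps)
  ultimately have "integrable lebesgue (\<lambda>x. (rep (c *\<^sub>R f + g) x)\<^sup>2)"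
    using meas by (subst integrable_cong_AE[symmetric]) auto
  moreover have "AE x in lebesgue. x \<notin> \<Omega> \<longrightarrow> rep (c *\<^sub>R f + g) x = 0"
    using AE_rep_lin[of c f g] L2_D(3)[OF f] L2_D(3)[OF g] by eventually_elim simp
  ultimately show ?thesis using meas by (simp add: L2_def)
qed

lemma measurable_lebesgue_continuous:
  fixes k :: "'a::euclidean_space \<Rightarrow> real"
  shows "continuous_on UNIV k \<Longrightarrow> k \<in> borel_measurable lebesgue"
  by (simp add: borel_measurable_continuous_onI measurable_completion)

lemma set_integrable_continuous_mult:
  fixes k h :: "'a::euclidean_space \<Rightarrow> real"
  assumes "continuous_on UNIV k" "bounded \<Omega>" "\<Omega> \<in> sets lebesgue"
    and "set_integrable lebesgue \<Omega> h"
  shows "set_integrable lebesgue \<Omega> (\<lambda>x. k x * h x)"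
proof -
  have h: "integrable lebesgue (\<lambda>x. indicator \<Omega> x * h x)"
    using assms(4) by (simp add: set_integrable_def)
  have "compact (k ` closure \<Omega>)"
    using assms(1,2) by (intro compact_continuous_image) (auto intro: continuous_on_subset simp: compact_closure)
  then obtain B where B: "\<And>y. y \<in> k ` closure \<Omega> \<Longrightarrow> norm y \<le> B"
    using compact_imp_bounded bounded_iff by metis
  have B: "\<bar>k x\<bar> \<le> B" if "x \<in> \<Omega>" for x
    using B[of "k x"] that closure_subset by auto
  have "integrable lebesgue (\<lambda>x. k x * (indicator \<Omega> x * h x))"
  proof (rule Bochner_Integration.integrable_bound)
    show "integrable lebesgue (\<lambda>x. B * (indicator \<Omega> x * h x))" using h by simp
    show "(\<lambda>x. k x * (indicator \<Omega> x * h x)) \<in> borel_measurable lebesgue"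
      using measurable_lebesgue_continuous[OF assms(1)] borel_measurable_integrable[OF h] by simp
    have "norm (k x * (indicator \<Omega> x * h x)) \<le> norm (B * (indicator \<Omega> x * h x))" for x
      using B[of x] by (cases "x \<in> \<Omega>") (auto simp: abs_mult intro!: mult_right_mono)
    then show "AE x in lebesgue. norm (k x * (indicator \<Omega> x * h x)) \<le> norm (B * (indicator \<Omega> x * h x))"
      by simp
  qed
  then show ?thesis by (simp add: set_integrable_def mult_ac)
qed

lemma integrable_imp_set_integrable:
  fixes h :: "'a::euclidean_space \<Rightarrow> real"
  shows "\<lbrakk>\<Omega> \<in> sets lebesgue; integrable lebesgue h\<rbrakk> \<Longrightarrow> set_integrable lebesgue \<Omega> h"
  unfolding set_integrable_def by (rule integrable_mult_indicator)

lemma L2_set_integrable: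
  assumes "f \<in> L2 \<Omega>" "bounded \<Omega>" "\<Omega> \<in> sets lebesgue"
  shows "set_integrable lebesgue \<Omega> (rep f)"
  unfolding set_integrable_def real_scaleR_def
proof (rule Bochner_Integration.integrable_bound)
  have "\<Omega> \<in> lmeasurable" using assms(2,3) by (rule bounded_set_imp_lmeasurable)
  then have "emeasure lebesgue \<Omega> < \<infinity>" unfolding fmeasurable_def infinity_ennreal_def by blast
  then have "integrable lebesgue (indicator \<Omega> :: 'a \<Rightarrow> real)"
    using assms(3) by (intro integrable_real_indicator) auto
  then show "integrable lebesgue (\<lambda>x. indicator \<Omega> x + (rep f x)\<^sup>2)"
    using L2_D(2)[OF assms(1)] by (rule Bochner_Integration.integrable_add)
  show "(\<lambda>x. indicator \<Omega> x * rep f x) \<in> borel_measurable lebesgue"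
    using assms(3) L2_D(1)[OF assms(1)] by (intro borel_measurable_times borel_measurable_indicator)
  have "\<bar>t\<bar> \<le> 1 + t\<^sup>2" for t :: real
    using sum_squares_bound[of 1 "\<bar>t\<bar>"] by simp
  then show "AE x in lebesgue. norm (indicator \<Omega> x * rep f x) \<le> norm (indicator \<Omega> x + (rep f x)\<^sup>2)"
    by (intro AE_I2) (simp add: indicator_def)
qed

lemma set_integral_lin:
  assumes "\<Omega> \<in> sets lebesgue" "f \<in> L2 \<Omega>" "g \<in> L2 \<Omega>" "h \<in> borel_measurable lebesgue"
    and fh: "set_integrable lebesgue \<Omega> (\<lambda>x. rep f x * h x)"
    and gh: "set_integrable lebesgue \<Omega> (\<lambda>x. rep g x * h x)"
  shows "(LINT x:\<Omega>|lebesgue. rep (c *\<^sub>R f + g) x * h x)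
    = c * (LINT x:\<Omega>|lebesgue. rep f x * h x) + (LINT x:\<Omega>|lebesgue. rep g x * h x)"
proof -
  have cfh: "set_integrable lebesgue \<Omega> (\<lambda>x. c * (rep f x * h x))"
    using fh by (intro set_integrable_mult_right)
  have "(LINT x:\<Omega>|lebesgue. rep (c *\<^sub>R f + g) x * h x)
      = (LINT x:\<Omega>|lebesgue. c * (rep f x * h x) + rep g x * h x)"
  proof (rule set_lebesgue_integral_cong_AE)
    show "AE x\<in>\<Omega> in lebesgue. rep (c *\<^sub>R f + g) x * h x = c * (rep f x * h x) + rep g x * h x"
      using AE_rep_lin[of c f g] by eventually_elim (simp add: algebra_simps)
  qed (use assms L2_D(1)[OF L2_lin[OF assms(2,3)]] L2_D(1)[OF assms(2)] L2_D(1)[OF assms(3)] in auto)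
  also have "\<dots> = c * (LINT x:\<Omega>|lebesgue. rep f x * h x) + (LINT x:\<Omega>|lebesgue. rep g x * h x)"
    using set_integral_add(2)[OF cfh gh] by simp
  finally show ?thesis .
qed

lemma set_integrable_L2_continuous:
  assumes "open \<Omega>" "bounded \<Omega>" "f \<in> L2 \<Omega>" "continuous_on UNIV k"
  shows "set_integrable lebesgue \<Omega> (\<lambda>x. rep f x * k x)"
  using set_integrable_continuous_mult[OF assms(4,2) _ L2_set_integrable[OF assms(3,2)]] assms(1)
  by (simp add: mult.commute lborelD)

text \<open>The definition of \<^const>\<open>weak_deriv\<close> by a definite description is meaningful only because of this
  uniqueness: the difference of two weak derivatives is orthogonal to all test functions.\<close>

lemma weak_deriv_unique:
  assumes \<Omega>: "open \<Omega>" "bounded \<Omega>"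
    and g: "g \<in> L2 \<Omega>" "has_weak_deriv \<Omega> i f g" and g': "g' \<in> L2 \<Omega>" "has_weak_deriv \<Omega> i f g'"
  shows "g = g'"
proof (rule ae_fun_eqI)
  define h where "h = (-1) *\<^sub>R g + g'"
  have h: "h \<in> L2 \<Omega>" unfolding h_def using g(1) g'(1) by (rule L2_lin)
  have \<Omega>_sets: "\<Omega> \<in> sets lebesgue" using \<Omega>(1) by (simp add: lborelD)
  have "AE x in lebesgue. x \<in> \<Omega> \<longrightarrow> rep h x = 0"
  proof (rule fundamental_lemma_of_variations[OF \<Omega>(1)])
    show "set_integrable lebesgue \<Omega> (rep h)"
      using set_integrable_L2_continuous[OF \<Omega> h continuous_on_const[of _ 1]] by simp
    fix \<phi> assume \<phi>: "test_fun \<Omega> \<phi>"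
    then have cont: "continuous_on UNIV \<phi>" by (simp add: test_fun_def continuous_on_smooth)
    have "(LINT x:\<Omega>|lebesgue. rep g x * \<phi> x) = (LINT x:\<Omega>|lebesgue. rep g' x * \<phi> x)"
      using g(2) g'(2) \<phi> unfolding has_weak_deriv_def by (metis neg_equal_iff_equal)
    then show "(LINT x:\<Omega>|lebesgue. rep h x * \<phi> x) = 0"
      unfolding h_def
      by (subst set_integral_lin[OF \<Omega>_sets g(1) g'(1) measurable_lebesgue_continuous[OF cont]
            set_integrable_L2_continuous[OF \<Omega> g(1) cont] set_integrable_L2_continuous[OF \<Omega> g'(1) cont]]) simp
  qed
  then show "AE x in lebesgue. rep g x = rep g' x"
    using L2_D(3)[OF h] AE_rep_lin[of "-1" g g', folded h_def] by eventually_elim force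
qed

lemma weak_deriv_eqI:
  assumes "open \<Omega>" "bounded \<Omega>" "g \<in> L2 \<Omega>" "has_weak_deriv \<Omega> i f g"
  shows "weak_deriv \<Omega> i f = g"
  unfolding weak_deriv_def using assms weak_deriv_unique by (intro the_equality) blast+

lemma weak_deriv_H1:
  assumes "open \<Omega>" "bounded \<Omega>" "f \<in> H1 \<Omega>" "i \<in> Basis"
  shows "weak_deriv \<Omega> i f \<in> L2 \<Omega>" "has_weak_deriv \<Omega> i f (weak_deriv \<Omega> i f)"
proof -
  obtain g where "g \<in> L2 \<Omega>" "has_weak_deriv \<Omega> i f g" using assms(3,4) by (auto simp: H1_def)
  with weak_deriv_eqI[OF assms(1,2) this]
  show "weak_deriv \<Omega> i f \<in> L2 \<Omega>" "has_weak_deriv \<Omega> i f (weak_deriv \<Omega> i f)" by simp_all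
qed

lemma H1_imp_L2: "f \<in> H1 \<Omega> \<Longrightarrow> f \<in> L2 \<Omega>"
  by (simp add: H1_def)

lemma has_weak_deriv_lin:
  assumes \<Omega>: "open \<Omega>" "bounded \<Omega>" and i: "i \<in> Basis"
    and f: "f \<in> L2 \<Omega>" "f' \<in> L2 \<Omega>" "has_weak_deriv \<Omega> i f f'"
    and g: "g \<in> L2 \<Omega>" "g' \<in> L2 \<Omega>" "has_weak_deriv \<Omega> i g g'"
  shows "has_weak_deriv \<Omega> i (c *\<^sub>R f + g) (c *\<^sub>R f' + g')"
  unfolding has_weak_deriv_def
proof (intro allI impI)
  have \<Omega>_sets: "\<Omega> \<in> sets lebesgue" using \<Omega>(1) by (simp add: lborelD)
  have lin: "(LINT x:\<Omega>|lebesgue. rep (c *\<^sub>R p + q) x * k x)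
      = c * (LINT x:\<Omega>|lebesgue. rep p x * k x) + (LINT x:\<Omega>|lebesgue. rep q x * k x)"
    if "p \<in> L2 \<Omega>" "q \<in> L2 \<Omega>" "continuous_on UNIV k" for p q k
    using that \<Omega>_sets \<Omega>
    by (intro set_integral_lin measurable_lebesgue_continuous set_integrable_L2_continuous)
  fix \<phi> assume \<phi>: "test_fun \<Omega> \<phi>"
  then have "continuous_on UNIV \<phi>" "continuous_on UNIV (partial i \<phi>)"
    using i by (auto simp: test_fun_def continuous_on_smooth continuous_on_partial_smooth)
  then show "(LINT x:\<Omega>|lebesgue. rep (c *\<^sub>R f + g) x * partial i \<phi> x)
      = - (LINT x:\<Omega>|lebesgue. rep (c *\<^sub>R f' + g') x * \<phi> x)"
    using f g \<phi> by (simp add: lin has_weak_deriv_def)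
qed

lemma weak_deriv_lin:
  assumes \<Omega>: "open \<Omega>" "bounded \<Omega>" and fg: "f \<in> H1 \<Omega>" "g \<in> H1 \<Omega>" and i: "i \<in> Basis"
  shows "weak_deriv \<Omega> i (c *\<^sub>R f + g) = c *\<^sub>R weak_deriv \<Omega> i f + weak_deriv \<Omega> i g"
  using weak_deriv_H1[OF \<Omega> fg(1) i] weak_deriv_H1[OF \<Omega> fg(2) i] fg[THEN H1_imp_L2]
  by (intro weak_deriv_eqI[OF \<Omega>] has_weak_deriv_lin[OF \<Omega> i] L2_lin)

lemma H1_lin:
  assumes \<Omega>: "open \<Omega>" "bounded \<Omega>" and fg: "f \<in> H1 \<Omega>" "g \<in> H1 \<Omega>"
  shows "c *\<^sub>R f + g \<in> H1 \<Omega>"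
proof -
  have "\<exists>h\<in>L2 \<Omega>. has_weak_deriv \<Omega> i (c *\<^sub>R f + g) h" if i: "i \<in> Basis" for i
    using weak_deriv_H1[OF \<Omega> fg(1) i] weak_deriv_H1[OF \<Omega> fg(2) i] fg[THEN H1_imp_L2]
    by (intro bexI[of _ "c *\<^sub>R weak_deriv \<Omega> i f + weak_deriv \<Omega> i g"] has_weak_deriv_lin[OF \<Omega> i] L2_lin)
  then show ?thesis using fg[THEN H1_imp_L2] by (auto simp: H1_def intro: L2_lin)
qed

section \<open>Linearity of the bilinear forms\<close>

text \<open>The terms of the Heston form are \<open>L\<^sup>2\<close> products with coefficients that are affine in the
  position. Linearity is proved once, for an arbitrary continuous coefficient.\<close>

definition weighted_inner ::
    "'a::euclidean_space set \<Rightarrow> ('a \<Rightarrow> real) \<Rightarrow> 'a ae_fun \<Rightarrow> 'a ae_fun \<Rightarrow> real" where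
  "weighted_inner \<Omega> k f g = (LINT x:\<Omega>|lebesgue. rep f x * (k x * rep g x))"

lemma L2_inner_eq_weighted: "L2_inner \<Omega> = weighted_inner \<Omega> (\<lambda>_. 1)"
  by (simp add: L2_inner_def weighted_inner_def fun_eq_iff)

lemma weighted_integrable:
  assumes "open \<Omega>" "bounded \<Omega>" "continuous_on UNIV k" "f \<in> L2 \<Omega>" "g \<in> L2 \<Omega>"
  shows "set_integrable lebesgue \<Omega> (\<lambda>x. rep f x * (k x * rep g x))"
proof -
  have "\<Omega> \<in> sets lebesgue" using assms(1) by (simp add: lborelD)
  from set_integrable_continuous_mult[OF assms(3,2) this
      integrable_imp_set_integrable[OF this L2_mult_integrable[OF assms(4,5)]]]
  show ?thesis by (simp add: mult_ac)
qed

lemma weighted_inner_lin: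
  assumes "open \<Omega>" "bounded \<Omega>" "continuous_on UNIV k" "f \<in> L2 \<Omega>" "g \<in> L2 \<Omega>" "h \<in> L2 \<Omega>"
  shows "weighted_inner \<Omega> k (c *\<^sub>R f + g) h = c * weighted_inner \<Omega> k f h + weighted_inner \<Omega> k g h"
  unfolding weighted_inner_def
  using assms borel_measurable_times[OF measurable_lebesgue_continuous[OF assms(3)] L2_D(1)[OF assms(6)]]
  by (intro set_integral_lin weighted_integrable) (auto simp: lborelD)

lemma L2_inner_lin:
  assumes "open \<Omega>" "bounded \<Omega>" "f \<in> L2 \<Omega>" "g \<in> L2 \<Omega>" "h \<in> L2 \<Omega>"
  shows "L2_inner \<Omega> (c *\<^sub>R f + g) h = c * L2_inner \<Omega> f h + L2_inner \<Omega> g h"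
  unfolding L2_inner_eq_weighted using assms by (intro weighted_inner_lin continuous_on_const)

text \<open>Elements of \<^const>\<open>L2\<close> vanish outside \<open>\<Omega>\<close>, so vanishing almost everywhere in \<open>\<Omega>\<close> is
  equality with \<open>0\<close>.\<close>

lemma L2_inner_self_eq_0:
  assumes "\<Omega> \<in> sets lebesgue" "f \<in> L2 \<Omega>" "L2_inner \<Omega> f f \<le> 0"
  shows "f = 0"
proof -
  have "integrable lebesgue (\<lambda>x. indicator \<Omega> x * (rep f x)\<^sup>2)"
    using integrable_imp_set_integrable[OF assms(1) L2_D(2)[OF assms(2)]]
    by (simp add: set_integrable_def)
  moreover have "(LINT x|lebesgue. indicator \<Omega> x * (rep f x)\<^sup>2) = 0"
    using assms(3) by (intro antisym Bochner_Integration.integral_nonneg)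
      (auto simp: L2_inner_def set_lebesgue_integral_def power2_eq_square)
  ultimately have "AE x in lebesgue. indicator \<Omega> x * (rep f x)\<^sup>2 = 0"
    by (subst (asm) integral_nonneg_eq_0_iff_AE) auto
  then have "AE x in lebesgue. rep f x = rep 0 x"
    using L2_D(3)[OF assms(2)] AE_rep_zero
    by eventually_elim (auto simp: indicator_def split: if_splits)
  then show ?thesis by (rule ae_fun_eqI)
qed

text \<open>Linearity in the first argument is what allows subtracting the equations of two solutions,
  tested with the same \<open>\<phi>\<close>.\<close>

definition linear_on_H1 :: "'a::euclidean_space set \<Rightarrow> ('a ae_fun \<Rightarrow> 'a ae_fun \<Rightarrow> real) \<Rightarrow> bool" where
  "linear_on_H1 \<Omega> a \<longleftrightarrow> (\<forall>f\<in>H1 \<Omega>. \<forall>g\<in>H1 \<Omega>. \<forall>\<phi>\<in>H1 \<Omega>. \<forall>c. a (c *\<^sub>R f + g) \<phi> = c * a f \<phi> + a g \<phi>)"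

lemma linear_black_scholes_form:
  assumes \<Omega>: "open \<Omega>" "bounded \<Omega>"
  shows "linear_on_H1 \<Omega> (black_scholes_form \<Omega> \<mu>)"
proof -
  obtain \<sigma> q r where \<mu>: "\<mu> = (\<sigma>, q, r)" by (metis prod_cases3)
  have "(1::real) \<in> Basis" by simp
  note D = weak_deriv_H1(1)[OF \<Omega> _ this] and lin = weak_deriv_lin[OF \<Omega> _ _ this]
  show ?thesis
    unfolding linear_on_H1_def \<mu>
    by (intro ballI allI) (simp add: lin L2_inner_lin[OF \<Omega>] D H1_imp_L2, simp add: algebra_simps)
qed

lemma heston_form_eq_weighted:
  fixes \<Omega> :: "(real \<times> real) set" and \<xi> \<rho> \<gamma> \<kappa> r :: real
  defines "k1 \<equiv> \<lambda>p. 1/2 * fst p * \<xi>\<^sup>2" and "k2 \<equiv> \<lambda>p. 1/2 * fst p * (\<rho> * \<xi>)" and "k3 \<equiv> \<lambda>p. 1/2 * fst p"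
    and "k4 \<equiv> \<lambda>p. - \<kappa> * (\<gamma> - fst p) + 1/2 * \<xi>\<^sup>2" and "k5 \<equiv> \<lambda>p. - r + 1/2 * fst p + 1/2 * \<xi> * \<rho>"
    and "dv \<equiv> weak_deriv \<Omega> (1, 0)" and "dx \<equiv> weak_deriv \<Omega> (0, 1)"
  assumes \<Omega>: "open \<Omega>" "bounded \<Omega>" and w: "w \<in> H1 \<Omega>" and \<phi>: "\<phi> \<in> H1 \<Omega>"
  shows "heston_form \<Omega> (\<xi>, \<rho>, \<gamma>, \<kappa>, r) w \<phi> =
    weighted_inner \<Omega> k1 (dv w) (dv \<phi>) + weighted_inner \<Omega> k2 (dx w) (dv \<phi>)
    + weighted_inner \<Omega> k2 (dv w) (dx \<phi>) + weighted_inner \<Omega> k3 (dx w) (dx \<phi>)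
    + weighted_inner \<Omega> k4 (dv w) \<phi> + weighted_inner \<Omega> k5 (dx w) \<phi> + r * L2_inner \<Omega> w \<phi>"
proof -
  have B: "(1, 0) \<in> (Basis :: (real \<times> real) set)" "(0, 1) \<in> (Basis :: (real \<times> real) set)"
    by (auto simp: Basis_prod_def)
  have cont: "continuous_on UNIV k1" "continuous_on UNIV k2" "continuous_on UNIV k3"
    "continuous_on UNIV k4" "continuous_on UNIV k5"
    unfolding k1_def k2_def k3_def k4_def k5_def by (intro continuous_intros)+
  have mem: "dv w \<in> L2 \<Omega>" "dx w \<in> L2 \<Omega>" "dv \<phi> \<in> L2 \<Omega>" "dx \<phi> \<in> L2 \<Omega>" "\<phi> \<in> L2 \<Omega>"
    unfolding dv_def dx_def using B \<Omega> w \<phi> by (auto intro: weak_deriv_H1 H1_imp_L2)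
  note int = weighted_integrable[OF \<Omega>]
  have diffusion: "(LINT p:\<Omega>|lebesgue.
      1/2 * fst p * (\<xi>\<^sup>2 * rep (dv w) p + \<rho> * \<xi> * rep (dx w) p) * rep (dv \<phi>) p
      + 1/2 * fst p * (\<rho> * \<xi> * rep (dv w) p + rep (dx w) p) * rep (dx \<phi>) p)
    = weighted_inner \<Omega> k1 (dv w) (dv \<phi>) + weighted_inner \<Omega> k2 (dx w) (dv \<phi>)
      + weighted_inner \<Omega> k2 (dv w) (dx \<phi>) + weighted_inner \<Omega> k3 (dx w) (dx \<phi>)" (is "?I = _")
  proof -
    let ?F = "\<lambda>k f g p. rep f p * (k p * rep g p)"
    have "?I = (LINT p:\<Omega>|lebesgue. ?F k1 (dv w) (dv \<phi>) p + ?F k2 (dx w) (dv \<phi>) p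
        + ?F k2 (dv w) (dx \<phi>) p + ?F k3 (dx w) (dx \<phi>) p)"
      by (rule arg_cong[where f = "set_lebesgue_integral lebesgue \<Omega>"])
         (simp add: fun_eq_iff k1_def k2_def k3_def algebra_simps)
    also have "\<dots> = weighted_inner \<Omega> k1 (dv w) (dv \<phi>) + weighted_inner \<Omega> k2 (dx w) (dv \<phi>)
        + weighted_inner \<Omega> k2 (dv w) (dx \<phi>) + weighted_inner \<Omega> k3 (dx w) (dx \<phi>)"
      unfolding weighted_inner_def by (simp only: set_integral_add weighted_integrable[OF \<Omega>] cont mem)
    finally show ?thesis .
  qed
  have convection: "(LINT p:\<Omega>|lebesgue.
      ((- \<kappa> * (\<gamma> - fst p) + 1/2 * \<xi>\<^sup>2) * rep (dv w) p
       + (- r + 1/2 * fst p + 1/2 * \<xi> * \<rho>) * rep (dx w) p) * rep \<phi> p)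
    = weighted_inner \<Omega> k4 (dv w) \<phi> + weighted_inner \<Omega> k5 (dx w) \<phi>" (is "?I = _")
  proof -
    let ?F = "\<lambda>k f g p. rep f p * (k p * rep g p)"
    have "?I = (LINT p:\<Omega>|lebesgue. ?F k4 (dv w) \<phi> p + ?F k5 (dx w) \<phi> p)"
      by (rule arg_cong[where f = "set_lebesgue_integral lebesgue \<Omega>"])
         (simp add: fun_eq_iff k4_def k5_def algebra_simps)
    also have "\<dots> = weighted_inner \<Omega> k4 (dv w) \<phi> + weighted_inner \<Omega> k5 (dx w) \<phi>"
      unfolding weighted_inner_def by (simp only: set_integral_add weighted_integrable[OF \<Omega>] cont mem)
    finally show ?thesis .
  qed
  show ?thesis
    using diffusion convection by (simp only: heston_form.simps Let_def dv_def dx_def add.assoc)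
qed

lemma linear_heston_form:
  assumes \<Omega>: "open \<Omega>" "bounded \<Omega>"
  shows "linear_on_H1 \<Omega> (heston_form \<Omega> \<mu>)"
proof -
  obtain \<xi> \<rho> \<gamma> \<kappa> r where \<mu>: "\<mu> = (\<xi>, \<rho>, \<gamma>, \<kappa>, r)" by (metis prod_cases5)
  have B: "(1, 0) \<in> (Basis :: (real \<times> real) set)" "(0, 1) \<in> (Basis :: (real \<times> real) set)"
    by (auto simp: Basis_prod_def)
  note D = weak_deriv_H1(1)[OF \<Omega> _ B(1)] weak_deriv_H1(1)[OF \<Omega> _ B(2)]
  note lin = weak_deriv_lin[OF \<Omega> _ _ B(1)] weak_deriv_lin[OF \<Omega> _ _ B(2)]
  show ?thesis
    unfolding linear_on_H1_def \<mu>
  proof (intro ballI allI)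
    fix f g \<phi> c
    assume H1: "f \<in> H1 \<Omega>" "g \<in> H1 \<Omega>" "\<phi> \<in> H1 \<Omega>"
    note W = weighted_inner_lin[OF \<Omega>]
    show "heston_form \<Omega> (\<xi>, \<rho>, \<gamma>, \<kappa>, r) (c *\<^sub>R f + g) \<phi>
        = c * heston_form \<Omega> (\<xi>, \<rho>, \<gamma>, \<kappa>, r) f \<phi> + heston_form \<Omega> (\<xi>, \<rho>, \<gamma>, \<kappa>, r) g \<phi>"
      using H1
      by (simp add: heston_form_eq_weighted[OF \<Omega>] H1_lin[OF \<Omega>] lin W L2_inner_lin[OF \<Omega>] D
          H1_imp_L2 continuous_intros distrib_left del: heston_form.simps)
  qed
qed

section \<open>Consequences of coercivity and inf-sup stability\<close>
lemma coercive_pos: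
  assumes "hilbert_on V ip" "0 < coercivity_const V ip a" "v \<in> V" "v \<noteq> 0"
  shows "0 < a v v"
proof -
  have "coercivity_const V ip a \<le> ereal (a v v / (ip_norm ip v)\<^sup>2)"
    unfolding coercivity_const_def using assms(3,4) by (intro INF_lower) simp
  with assms(2) have "0 < ereal (a v v / (ip_norm ip v)\<^sup>2)" by (rule less_le_trans)
  then have "0 < a v v / (ip_norm ip v)\<^sup>2" by simp
  then show ?thesis
    using zero_le_power2[of "ip_norm ip v"] by (simp add: zero_less_divide_iff not_less[symmetric])
qed

text \<open>A nonzero \<open>\<eta>\<close> that vanishes on \<open>Y\<close> would contribute a supremum of zeros, or a supremum over the
  empty set, to the infimum.\<close>

lemma infsup_annihilator:
  assumes "0 < infsup_const V ip X Y" "\<eta> \<in> X" "\<And>v. v \<in> Y \<Longrightarrow> \<eta> v = 0"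
  shows "\<eta> = (\<lambda>_. 0)"
proof (rule ccontr)
  assume "\<eta> \<noteq> (\<lambda>_. 0)"
  then have "infsup_const V ip X Y
      \<le> (SUP v\<in>Y - {0}. ereal (pairing \<eta> v / (dual_norm V ip \<eta> * ip_norm ip v)))"
    unfolding infsup_const_def using assms(2) by (intro INF_lower) simp
  also have "\<dots> \<le> 0"
    using assms(3) by (intro SUP_least) (simp add: pairing_def)
  finally show False using assms(1) by simp
qed

lemma fun_cone_subset:
  assumes "closed_convex_cone V ip M" "\<xi> ` {1..N} \<subseteq> M"
  shows "fun_cone \<xi> N \<subseteq> M"
proof
  fix \<eta> assume "\<eta> \<in> fun_cone \<xi> N"
  then obtain \<alpha> where \<alpha>: "\<eta> = lincomb \<xi> N \<alpha>" "\<And>j. j \<in> {1..N} \<Longrightarrow> 0 \<le> \<alpha> j"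
    by (auto simp: fun_cone_def)
  have scale: "(\<lambda>v. c * \<zeta> v) \<in> M" if "\<zeta> \<in> M" "0 \<le> c" for \<zeta> c
    using assms(1) that by (simp add: closed_convex_cone_def)
  have add: "(\<lambda>v. \<zeta> v + \<zeta>' v) \<in> M" if "\<zeta> \<in> M" "\<zeta>' \<in> M" for \<zeta> \<zeta>'
    using assms(1) that by (simp add: closed_convex_cone_def)
  obtain \<zeta> where "\<zeta> \<in> M" using assms(1) by (auto simp: closed_convex_cone_def)
  then have zero: "(\<lambda>_. 0) \<in> M" using scale[of \<zeta> 0] by simp
  have "(\<lambda>v. \<Sum>j\<in>J. \<alpha> j * \<xi> j v) \<in> M" if "finite J" "J \<subseteq> {1..N}" for J
    using that
  proof induction
    case empty
    then show ?case using zero by simp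
  next
    case (insert j J)
    then have "\<xi> j \<in> M" "0 \<le> \<alpha> j" using assms(2) \<alpha>(2) by auto
    with insert show ?case by (simp add: add[OF scale])
  qed
  then show "\<eta> \<in> M" unfolding \<alpha>(1) lincomb_def by simp
qed

lemma fun_cone_diff_in_span:
  assumes "\<eta> \<in> fun_cone \<xi> N" "\<zeta> \<in> fun_cone \<xi> N"
  shows "\<eta> - \<zeta> \<in> fun_span \<xi> N"
proof -
  obtain \<alpha> \<beta> where "\<eta> = lincomb \<xi> N \<alpha>" "\<zeta> = lincomb \<xi> N \<beta>"
    using assms by (auto simp: fun_cone_def)
  then have "\<eta> - \<zeta> = lincomb \<xi> N (\<lambda>j. \<alpha> j - \<beta> j)"
    by (simp add: lincomb_def fun_eq_iff sum_subtractf left_diff_distrib)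
  then show ?thesis by (auto simp: fun_span_def)
qed

section \<open>Reproduction of solutions\<close>

context reduced_basis_setting
begin

lemma subspace_V: "subspace V"
  using V_hilbert by (simp add: hilbert_on_def)

lemma V_subset_H1: "V \<subseteq> H1 \<Omega>"
  by (auto simp: V_eq H1_D_def)

lemma reduced_space_subset: "span (\<psi> ` {1..NV}) \<subseteq> V"
  using primal_basis(1) subspace_V by (rule span_minimal)

lemma reduced_infsup_pos: "0 < infsup_const V ip (fun_span \<xi> NW) (span (\<psi> ` {1..NV}))"
  using b_infsup reduced_infsup by (rule less_le_trans)

text \<open>Here \<open>e\<close> and \<open>\<delta>\<close> are the differences of the primal and dual components of two solutions of one
  time step. Testing with \<open>e\<close> itself bounds \<open>\<tau> \<parallel>e\<parallel>\<^sup>2 + \<theta> a(e, e)\<close> by \<open>\<delta> e \<le> 0\<close>, and the \<open>L\<^sup>2\<close> term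
  alone then forces \<open>e = 0\<close>, also for the explicit scheme \<open>\<theta> = 0\<close>. What remains of the equation says
  that \<open>\<delta>\<close> annihilates the reduced space, which inf-sup stability allows only for \<open>\<delta> = 0\<close>.\<close>

lemma homogeneous_step_trivial:
  assumes \<Omega>: "open \<Omega>" "bounded \<Omega>" and \<mu>: "\<mu> \<in> P" and lin: "linear_on_H1 \<Omega> (a \<mu>)"
    and e: "e \<in> span (\<psi> ` {1..NV})" and \<delta>: "\<delta> \<in> fun_span \<xi> NW" and "0 < \<tau>"
    and eq: "\<And>\<phi>. \<phi> \<in> span (\<psi> ` {1..NV}) \<Longrightarrow> \<tau> * L2_inner \<Omega> e \<phi> + \<theta> * a \<mu> e \<phi> = \<delta> \<phi>"
    and sign: "\<delta> e \<le> 0"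
  shows "e = 0 \<and> \<delta> = (\<lambda>_. 0)"
proof -
  have eV: "e \<in> V" using e reduced_space_subset by blast
  have "e = 0"
  proof (rule ccontr)
    assume "e \<noteq> 0"
    then have "0 \<le> \<theta> * a \<mu> e e"
      using coercive_pos[OF V_hilbert a_coercive[OF \<mu>] eV] time(3) by simp
    then have "\<tau> * L2_inner \<Omega> e e \<le> 0" using eq[OF e] sign by simp
    then have "L2_inner \<Omega> e e \<le> 0" using \<open>0 < \<tau>\<close> by (simp add: mult_le_0_iff)
    then have "e = 0"
      using \<Omega>(1) eV V_subset_H1 by (intro L2_inner_self_eq_0[of \<Omega>]) (auto simp: H1_imp_L2 lborelD)
    with \<open>e \<noteq> 0\<close> show False ..
  qed
  have zero: "L2_inner \<Omega> 0 \<phi> = 0" "a \<mu> 0 \<phi> = 0" if "\<phi> \<in> V" for \<phi>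
  proof -
    have "0 \<in> H1 \<Omega>" "\<phi> \<in> H1 \<Omega>" using V_subset_H1 subspace_0[OF subspace_V] that by auto
    then show "L2_inner \<Omega> 0 \<phi> = 0" "a \<mu> 0 \<phi> = 0"
      using L2_inner_lin[OF \<Omega>, of 0 0 \<phi> 1] lin[unfolded linear_on_H1_def, rule_format, of 0 0 \<phi> 1]
      by (simp_all add: H1_imp_L2)
  qed
  have "\<delta> = (\<lambda>_. 0)"
  proof (rule infsup_annihilator[OF reduced_infsup_pos \<delta>])
    fix v assume "v \<in> span (\<psi> ` {1..NV})"
    then show "\<delta> v = 0"
      using eq[of v] zero[of v] reduced_space_subset \<open>e = 0\<close> by auto
  qed
  with \<open>e = 0\<close> show ?thesis ..
qed

text \<open>Since \<open>M\<^sub>N \<subseteq> M\<close>, the reduced multiplier is admissible in the detailed inequality, and the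
  detailed multiplier lies in \<open>M\<^sub>N\<close> by assumption. Testing each inequality with the other
  multiplier and adding gives the sign condition of the preceding lemma. Knowing that both
  solutions agree at step \<open>n\<close>, the difference at step \<open>n + 1\<close> solves the homogeneous equation.\<close>

theorem reproduction_of_solutions:
  assumes \<Omega>: "open \<Omega>" "bounded \<Omega>" and \<mu>: "\<mu> \<in> P" and lin: "linear_on_H1 \<Omega> (a \<mu>)"
    and detailed: "detailed_solution \<Omega> w0 (a \<mu>) T L \<theta> ug V M u lam"
    and reduced: "reduced_solution \<Omega> w0 (a \<mu>) T L \<theta> ug ip (span (\<psi> ` {1..NV})) (fun_cone \<xi> NW)
      (u 0) uN lamN"
    and u0: "u 0 \<in> span (\<psi> ` {1..NV})"
    and u_lam: "\<And>n. n < L \<Longrightarrow> u (Suc n) \<in> span (\<psi> ` {1..NV}) \<and> lam (Suc n) \<in> fun_cone \<xi> NW"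
    and "n < L"
  shows "uN (Suc n) = u (Suc n) \<and> lamN (Suc n) = lam (Suc n)"
proof -
  let ?VN = "span (\<psi> ` {1..NV})" and ?MN = "fun_cone \<xi> NW"
  define \<tau> where "\<tau> = 1 / (T / real L)"
  have "0 < \<tau>" using time(1,2) by (simp add: \<tau>_def)
  have initial: "uN 0 = u 0"
  proof (rule ccontr)
    assume "uN 0 \<noteq> u 0"
    have "uN 0 - u 0 \<in> ?VN" using u0 reduced by (simp add: reduced_solution_def span_diff)
    then have "ip (uN 0 - u 0) (uN 0 - u 0) = 0" "uN 0 - u 0 \<in> V"
      using reduced reduced_space_subset by (auto simp: reduced_solution_def)
    moreover have "0 < ip v v" if "v \<in> V" "v \<noteq> 0" for v
      using V_hilbert that by (simp add: hilbert_on_def)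
    ultimately show False using \<open>uN 0 \<noteq> u 0\<close> by force
  qed
  have step: "uN (Suc n) = u (Suc n) \<and> lamN (Suc n) = lam (Suc n)" if "n < L" and prev: "uN n = u n" "u n \<in> ?VN" for n
  proof -
    define e where "e = uN (Suc n) - u (Suc n)"
    define \<delta> where "\<delta> = lamN (Suc n) - lam (Suc n)"
    have D: "\<And>\<phi>. \<phi> \<in> V \<Longrightarrow> L2_inner \<Omega> (\<tau> *\<^sub>R (u (Suc n) - u n)) \<phi> + a \<mu> (\<theta> *\<^sub>R u (Suc n) + (1 - \<theta>) *\<^sub>R u n) \<phi>
        - lam (Suc n) \<phi> = f_rhs \<Omega> (a \<mu>) (T / real L) \<theta> ug n \<phi>"
      "\<And>\<eta>. \<eta> \<in> M \<Longrightarrow> g_rhs \<Omega> w0 ug n (\<eta> - lam (Suc n)) \<le> (\<eta> - lam (Suc n)) (u (Suc n))"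
      using detailed \<open>n < L\<close> by (auto simp: detailed_solution_def time_steps_def Let_def pairing_def \<tau>_def)
    have R: "uN (Suc n) \<in> ?VN" "lamN (Suc n) \<in> ?MN"
      "\<And>\<phi>. \<phi> \<in> ?VN \<Longrightarrow> L2_inner \<Omega> (\<tau> *\<^sub>R (uN (Suc n) - uN n)) \<phi> + a \<mu> (\<theta> *\<^sub>R uN (Suc n) + (1 - \<theta>) *\<^sub>R uN n) \<phi>
        - lamN (Suc n) \<phi> = f_rhs \<Omega> (a \<mu>) (T / real L) \<theta> ug n \<phi>"
      "\<And>\<eta>. \<eta> \<in> ?MN \<Longrightarrow> g_rhs \<Omega> w0 ug n (\<eta> - lamN (Suc n)) \<le> (\<eta> - lamN (Suc n)) (uN (Suc n))"
      using reduced \<open>n < L\<close> by (auto simp: reduced_solution_def time_steps_def Let_def pairing_def \<tau>_def)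
    have e: "e \<in> ?VN" unfolding e_def using R(1) u_lam[OF \<open>n < L\<close>] by (intro span_diff) auto
    have \<delta>: "\<delta> \<in> fun_span \<xi> NW" unfolding \<delta>_def using R(2) u_lam[OF \<open>n < L\<close>] by (intro fun_cone_diff_in_span) auto
    have "\<tau> * L2_inner \<Omega> e \<phi> + \<theta> * a \<mu> e \<phi> = \<delta> \<phi>" if \<phi>: "\<phi> \<in> ?VN" for \<phi>
    proof -
      define p where "p = \<tau> *\<^sub>R (u (Suc n) - u n)"
      define q where "q = \<theta> *\<^sub>R u (Suc n) + (1 - \<theta>) *\<^sub>R u n"
      have "p \<in> ?VN" "q \<in> ?VN"
        unfolding p_def q_def using prev(2) u_lam[OF \<open>n < L\<close>] by (auto intro: span_scale span_add span_diff)
      then have H1: "p \<in> H1 \<Omega>" "q \<in> H1 \<Omega>" "e \<in> H1 \<Omega>" "\<phi> \<in> H1 \<Omega>"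
        using e \<phi> reduced_space_subset V_subset_H1 by auto
      have "\<tau> *\<^sub>R (uN (Suc n) - uN n) = \<tau> *\<^sub>R e + p"
        "\<theta> *\<^sub>R uN (Suc n) + (1 - \<theta>) *\<^sub>R uN n = \<theta> *\<^sub>R e + q"
        by (simp_all add: p_def q_def e_def prev(1) algebra_simps)
      then have "L2_inner \<Omega> (\<tau> *\<^sub>R (uN (Suc n) - uN n)) \<phi> = \<tau> * L2_inner \<Omega> e \<phi> + L2_inner \<Omega> p \<phi>"
        "a \<mu> (\<theta> *\<^sub>R uN (Suc n) + (1 - \<theta>) *\<^sub>R uN n) \<phi> = \<theta> * a \<mu> e \<phi> + a \<mu> q \<phi>"
        using L2_inner_lin[OF \<Omega>] lin H1 by (simp_all add: linear_on_H1_def H1_imp_L2)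
      moreover have "\<phi> \<in> V" using \<phi> reduced_space_subset by blast
      ultimately show ?thesis
        using D(1)[of \<phi>] R(3)[OF \<phi>] by (simp add: p_def q_def \<delta>_def)
    qed
    moreover have "\<delta> e \<le> 0"
    proof -
      have "lamN (Suc n) \<in> M" using R(2) fun_cone_subset[OF M_cone dual_basis(1)] by blast
      moreover have "lam (Suc n) - lamN (Suc n) = - \<delta>" by (simp add: \<delta>_def fun_eq_iff)
      ultimately have "g_rhs \<Omega> w0 ug n \<delta> \<le> \<delta> (u (Suc n))"
        "g_rhs \<Omega> w0 ug n (- \<delta>) \<le> - \<delta> (uN (Suc n))"
        using D(2)[of "lamN (Suc n)"] R(4)[of "lam (Suc n)"] u_lam[OF \<open>n < L\<close>] by (simp_all add: \<delta>_def)
      \<comment> \<open>The right-hand sides cancel when the two inequalities are added, leaving \<open>\<delta> (uN - u) \<le> 0\<close>.\<close>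
      moreover have "g_rhs \<Omega> w0 ug n (- \<delta>) = - g_rhs \<Omega> w0 ug n \<delta>"
        by (simp add: g_rhs_def pairing_def)
      \<comment> \<open>Functionals are additive only on \<open>V\<close>, outside of which they are extended by zero.\<close>
      moreover have "\<delta> (e + u (Suc n)) = \<delta> e + \<delta> (u (Suc n))"
      proof -
        have add: "\<eta> (v + w) = \<eta> v + \<eta> w" if "\<eta> \<in> M" "v \<in> V" "w \<in> V" for \<eta> v w
          using M_cone that by (auto simp: closed_convex_cone_def dual_def)
        have "lam (Suc n) \<in> M" "e \<in> V" "u (Suc n) \<in> V"
          using fun_cone_subset[OF M_cone dual_basis(1)] u_lam[OF \<open>n < L\<close>] e reduced_space_subset by auto
        with \<open>lamN (Suc n) \<in> M\<close> show ?thesis by (simp add: \<delta>_def add)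
      qed
      ultimately show ?thesis by (simp add: e_def)
    qed
    ultimately have "e = 0 \<and> \<delta> = (\<lambda>_. 0)"
      by (rule homogeneous_step_trivial[OF \<Omega> \<mu> lin e \<delta> \<open>0 < \<tau>\<close>])
    then show ?thesis by (simp add: e_def \<delta>_def fun_eq_iff)
  qed
  \<comment> \<open>The induction runs over \<open>n \<le> L\<close>; the step is available for \<open>n < L\<close> only.\<close>
  have "uN n = u n \<and> u n \<in> ?VN" if "n \<le> L" for n
    using that by (induction n) (use initial u0 step u_lam in auto)
  then show ?thesis using step \<open>n < L\<close> by simp
qed

end

theorem lemma3p2:
  shows
   "(\<forall>(xmin::real) (xmax::real) (K::real) P T L \<theta> ug V ip M NV \<psi> NW \<xi> \<mu> u lam uN lamN.
      let \<Omega> = {xmin<..<xmax}; \<Gamma> = interval_ends xmin xmax; w0 = payoff K;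
          a = black_scholes_form \<Omega>; VN = span (\<psi> ` {1..NV}); MN = fun_cone \<xi> NW
      in xmin < xmax \<longrightarrow> 0 < K \<longrightarrow>
         reduced_basis_setting \<Omega> \<Gamma> w0 P a T L \<theta> ug V ip M NV \<psi> NW \<xi> \<longrightarrow>
         \<mu> \<in> P \<longrightarrow>
         detailed_solution \<Omega> w0 (a \<mu>) T L \<theta> ug V M u lam \<longrightarrow>
         reduced_solution \<Omega> w0 (a \<mu>) T L \<theta> ug ip VN MN (u 0) uN lamN \<longrightarrow>
         u 0 \<in> VN \<longrightarrow>
         (\<forall>n<L. u (Suc n) \<in> VN \<and> lam (Suc n) \<in> MN) \<longrightarrow>
         (\<forall>n<L. uN (Suc n) = u (Suc n) \<and> lamN (Suc n) = lam (Suc n)))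
    \<and>
    (\<forall>(vmin::real) (vmax::real) (xmin::real) (xmax::real) (K::real)
        P T L \<theta> ug V ip M NV \<psi> NW \<xi> \<mu> u lam uN lamN.
      let \<Omega> = {vmin<..<vmax} \<times> {xmin<..<xmax}; \<Gamma> = rectangle_sides vmin vmax xmin xmax;
          w0 = (\<lambda>p. payoff K (snd p));
          a = heston_form \<Omega>; VN = span (\<psi> ` {1..NV}); MN = fun_cone \<xi> NW
      in 0 < vmin \<longrightarrow> vmin < vmax \<longrightarrow> xmin < xmax \<longrightarrow> 0 < K \<longrightarrow>
         reduced_basis_setting \<Omega> \<Gamma> w0 P a T L \<theta> ug V ip M NV \<psi> NW \<xi> \<longrightarrow>
         \<mu> \<in> P \<longrightarrow>
         detailed_solution \<Omega> w0 (a \<mu>) T L \<theta> ug V M u lam \<longrightarrow>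
         reduced_solution \<Omega> w0 (a \<mu>) T L \<theta> ug ip VN MN (u 0) uN lamN \<longrightarrow>
         u 0 \<in> VN \<longrightarrow>
         (\<forall>n<L. u (Suc n) \<in> VN \<and> lam (Suc n) \<in> MN) \<longrightarrow>
         (\<forall>n<L. uN (Suc n) = u (Suc n) \<and> lamN (Suc n) = lam (Suc n)))"
proof (rule conjI, goal_cases)
  case 1
  show ?case
    unfolding Let_def
    by (intro allI impI, rule reduced_basis_setting.reproduction_of_solutions, assumption)
       (auto intro: linear_black_scholes_form)
next
  case 2
  have rectangle: "open ({vmin<..<vmax} \<times> {xmin<..<xmax})" "bounded ({vmin<..<vmax} \<times> {xmin<..<xmax})"
    for vmin vmax xmin xmax :: real
    by (auto intro: open_Times bounded_Times)
  show ?case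
    unfolding Let_def
    by (intro allI impI, rule reduced_basis_setting.reproduction_of_solutions, assumption)
       (auto intro: rectangle linear_heston_form)
qed

end
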